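(* Let $w\in\mathbb{C}$ with $\operatorname{Re}(w)>-1$, and let $\alpha\in\mathbb{C}$ be such that either $\operatorname{Im}(\alpha)>0$ or $\alpha$ is an integer with $\alpha\ge 1$. Then $$\int_{-\infty}^{\infty}\binom{w}{x}\frac{1}{x+\alpha}\,dx=\sum_{k=0}^{\infty}\binom{w}{k}\frac{1}{k+\alpha}-e^{i\pi\alpha}B(w+1,\alpha).$$
   Context: For $w\in\mathbb{C}$ not a negative integer and $z\in\mathbb{C}$, the generalized binomial coefficient is $\binom{w}{z}=\frac{\Gamma(w+1)}{\Gamma(z+1)\Gamma(w-z+1)}$, where the reciprocal gamma function $1/\Gamma$ is understood as an entire function (equal to $0$ at the nonpositive integers). For an integer $k\ge 1$ one has $\binom{w}{k}=\frac{w(w-1)\cdots(w-k+1)}{k!}$, and $\binom{w}{0}=1$. $B$ is the beta function, $B(p,q)=\frac{\Gamma(p)\Gamma(q)}{\Gamma(p+q)}$ for $p,q\in\mathbb{C}\setminus\mathbb{Z}_{\le 0}$; equivalently $B(p,q)=\sum_{k=0}^{\infty}\binom{p-1}{k}\frac{(-1)^k}{q+k}$ for $\operatorname{Re}(p)>0$ and $q\notin\mathbb{Z}_{\le 0}$. *)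

theory Defs
  imports "HOL-Analysis.Analysis"
begin

text \<open>
  Here \<^const>\<open>rGamma\<close> is the entire function \<open>1/\<Gamma>\<close>, which vanishes at the nonpositive
  integers. The definition is meaningful when \<open>w\<close> is not a negative integer.
\<close>

definition cbinom :: "complex \<Rightarrow> complex \<Rightarrow> complex" where
  "cbinom w z = Gamma (w + 1) * rGamma (z + 1) * rGamma (w - z + 1)"

lemma cbinom_of_nat:
  assumes "w + 1 \<notin> \<int>\<^sub>\<le>\<^sub>0"
  shows "cbinom w (of_nat k) = w gchoose k"
proof -
  have w: "\<forall>n. w \<noteq> - of_nat (Suc n)"
  proof (intro allI notI)
    fix n assume "w = - of_nat (Suc n)"
    then have "w + 1 = - of_nat n" by simp
    with assms show False by simp
  qed
  have "rGamma (of_nat k + 1 :: complex) = inverse (fact k)"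
    by (simp add: rGamma_inverse_Gamma Gamma_fact add.commute)
  with gbinomial_Gamma[of w k] assms show ?thesis
    by (simp add: cbinom_def rGamma_inverse_Gamma field_simps)
qed

end

theory Submission
  imports Defs "HOL-Complex_Analysis.Complex_Analysis" "HOL-Real_Asymp.Real_Asymp"
begin

text \<open>
  Idea. For real \<open>x\<close> the binomial coefficient is a Fourier coefficient of the boundary function
  \<open>(1 + e\<^sup>i\<^sup>t)\<^sup>w\<close> on \<open>(-\<pi>, \<pi>)\<close>. Inserting this representation, Fubini's theorem and the Fourier
  transform of \<open>1/(x + \<alpha>)\<close>, which is supported on \<open>t > 0\<close>, turn the integral over \<open>x\<close> into
  \<open>-i\<close> times the integral of \<open>(1 + e\<^sup>i\<^sup>t)\<^sup>w e\<^sup>i\<^sup>\<alpha>\<^sup>t\<close> over \<open>(0, \<pi>)\<close>. Expanding the power in the binomial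
  series and integrating termwise, the endpoint \<open>t = 0\<close> contributes the series and the endpoint
  \<open>t = \<pi>\<close> contributes \<open>e\<^sup>i\<^sup>\<pi>\<^sup>\<alpha>\<close> times the alternating series, which is the beta function. The same
  termwise integration over \<open>(-\<pi>, \<pi>)\<close>, combined with the reflection formula, yields the Fourier
  representation. As \<open>1/(x + \<alpha>)\<close> is not integrable, Fubini's theorem is applied to a difference
  of two such kernels, and the second pole is then moved to \<open>i\<infinity>\<close>. Positive integers
  \<open>\<alpha>\<close> are limits of points in the upper half-plane.
\<close>

section \<open>Growth of binomial coefficients\<close>

lemma add_one_notin_nonpos_Ints:
  fixes w :: complex
  assumes "Re w > -1"
  shows "w + 1 \<notin> \<int>\<^sub>\<le>\<^sub>0"
  using assms by (auto elim!: nonpos_Ints_cases simp: complex_eq_iff)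

lemma add_of_nat_nonzero:
  fixes q :: complex
  assumes "q \<notin> \<int>\<^sub>\<le>\<^sub>0"
  shows "of_nat k + q \<noteq> 0"
  using assms by (metis add.commute add_eq_0_iff minus_of_nat_in_nonpos_Ints)

text \<open>Squaring gives |1 - u|^2 = 1 + (|u|^2 - 2 Re u), to which 1 + v <= e^v applies. The
  first-order term - Re u is kept exactly, so products of such factors turn into sums whose
  quadratic error converges.\<close>

lemma norm_one_minus_le_exp:
  fixes u :: complex
  shows "norm (1 - u) \<le> exp (norm u ^ 2 / 2 - Re u)"
proof -
  have "norm (1 - u) ^ 2 = 1 + (norm u ^ 2 - 2 * Re u)"
    unfolding cmod_power2 by (simp add: power2_eq_square algebra_simps)
  also have "\<dots> \<le> exp (norm u ^ 2 - 2 * Re u)"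
    by (rule exp_ge_add_one_self)
  also have "\<dots> = exp (norm u ^ 2 / 2 - Re u) ^ 2"
    by (simp flip: exp_double add: algebra_simps)
  finally show ?thesis
    by (rule power2_le_imp_le) simp
qed

text \<open>
  The complex shift \<open>\<zeta>\<close> makes the bound applicable to both ends of the real line:
  by symmetry, \<open>x \<rightarrow> -\<infinity>\<close> amounts to moving to the right from \<open>w\<close> instead of \<open>0\<close>.
\<close>

lemma norm_prod_one_minus_divide_le:
  fixes z \<zeta> :: complex
  assumes z: "Re z \<ge> 0" and \<delta>: "0 < \<delta>" "\<delta> \<le> 1" and \<zeta>: "\<delta> - 1 \<le> Re \<zeta>"
  shows "(\<Prod>j=1..n. norm (1 - z / (\<zeta> + of_nat j)))
           \<le> exp (norm z ^ 2 / \<delta> ^ 2 + norm z * norm (1 - \<zeta>) / \<delta>) * ((real n + 2) / 2) powr (- Re z)"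
proof -
  define K where "K = norm z ^ 2 / \<delta> ^ 2 + norm z * norm (1 - \<zeta>) / \<delta>"
  have K: "K \<ge> 0"
    using \<delta> by (simp add: K_def)
  \<comment> \<open>The bound is shaped so that both parts telescope: 1 - 1/(n+1) is the sum of
    1/(j(j+1)) for j = 1..n, and the logarithm vanishes at n = 0.\<close>
  have "(\<Prod>j=1..n. norm (1 - z / (\<zeta> + of_nat j)))
          \<le> exp (K * (1 - 1 / (real n + 1)) - Re z * ln ((real n + 2) / 2))"
  proof (induction n)
    case (Suc n)
    define s where "s = \<zeta> + of_nat (Suc n)"
    have s: "norm s \<ge> \<delta> * (real n + 1)"
    proof -
      have "\<delta> * real n \<le> 1 * real n"
        using \<delta> by (intro mult_right_mono) auto
      then have "\<delta> * (real n + 1) \<le> Re s"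
        using \<zeta> by (simp add: s_def algebra_simps)
      then show ?thesis
        using complex_Re_le_cmod order_trans by blast
    qed
    moreover have "\<delta> * (real n + 1) > 0"
      using \<delta> by simp
    ultimately have s0: "norm s > 0"
      by linarith
    have "norm (1 - z / s) \<le> exp (norm (z / s) ^ 2 / 2 - Re (z / s))"
      by (rule norm_one_minus_le_exp)
    \<comment> \<open>Together with n + 2 <= 2(n + 1), the lower bound on |s| puts the quadratic
      error into the first summand of \<open>K\<close>.\<close>
    moreover have "norm (z / s) ^ 2 / 2 \<le> norm z ^ 2 / \<delta> ^ 2 * (1 / ((real n + 1) * (real n + 2)))"
    proof -
      have "(\<delta> ^ 2 * (real n + 1)) * (real n + 2) \<le> (\<delta> ^ 2 * (real n + 1)) * (2 * (real n + 1))"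
        by (intro mult_left_mono) auto
      also have "\<dots> = 2 * (\<delta> * (real n + 1)) ^ 2"
        by (simp add: power2_eq_square)
      also have "\<dots> \<le> 2 * norm s ^ 2"
        using s \<delta> by (intro mult_left_mono power_mono) auto
      finally have "norm z ^ 2 / (2 * norm s ^ 2) \<le> norm z ^ 2 / ((\<delta> ^ 2 * (real n + 1)) * (real n + 2))"
        using s0 \<delta> by (intro divide_left_mono) auto
      then show ?thesis
        by (simp add: norm_divide power_divide mult_ac)
    qed
    \<comment> \<open>Two replacements: \<open>s\<close> by n + 2, from which it differs by
      \<open>1 - \<zeta>\<close> (the second summand of \<open>K\<close>), then 1/(n+2) by the
      increment of the logarithm, using ln(1 + u) <= u and Re z >= 0.\<close>
    moreover have "Re (z / s) \<ge> Re z * (ln ((real n + 3) / 2) - ln ((real n + 2) / 2))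
        - norm z * norm (1 - \<zeta>) / \<delta> * (1 / ((real n + 1) * (real n + 2)))"
    proof -
      have n2: "(of_nat n + 2 :: complex) \<noteq> 0"
        by (metis of_nat_add of_nat_numeral of_nat_eq_0_iff add_is_0 numeral_neq_zero)
      have "z / s - z / (of_nat n + 2) = z * (1 - \<zeta>) / (s * (of_nat n + 2))"
        using s0 n2 by (simp add: divide_simps) (simp add: s_def algebra_simps)
      then have "norm (z / s - z / (of_nat n + 2)) = norm z * norm (1 - \<zeta>) / (norm s * (real n + 2))"
        by (simp add: norm_mult norm_divide) (metis norm_of_nat of_nat_add of_nat_numeral)
      also have "\<dots> \<le> norm z * norm (1 - \<zeta>) / (\<delta> * (real n + 1) * (real n + 2))"
        using s s0 \<delta> by (intro divide_left_mono mult_right_mono) auto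
      finally have "Re (z / (of_nat n + 2)) - Re (z / s)
          \<le> norm z * norm (1 - \<zeta>) / \<delta> * (1 / ((real n + 1) * (real n + 2)))"
        using abs_Re_le_cmod[of "z / s - z / (of_nat n + 2)"] by (simp add: mult_ac)
      moreover have "Re (z / (of_nat n + 2)) = Re z * (1 / (real n + 2))"
        using Re_divide_of_nat[of z "n + 2"] by simp
      moreover have "ln ((real n + 3) / 2) - ln ((real n + 2) / 2) = ln (1 + 1 / (real n + 2))"
        by (subst ln_divide_pos [symmetric]) (auto simp: divide_simps algebra_simps intro: arg_cong[of _ _ ln])
      then have "ln ((real n + 3) / 2) - ln ((real n + 2) / 2) \<le> 1 / (real n + 2)"
        using ln_add_one_self_le_self[of "1 / (real n + 2)"] by simp
      then have "Re z * (ln ((real n + 3) / 2) - ln ((real n + 2) / 2)) \<le> Re z * (1 / (real n + 2))"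
        using z by (rule mult_left_mono)
      ultimately show ?thesis by linarith
    qed
    ultimately have "norm (1 - z / s) \<le> exp (K * (1 / ((real n + 1) * (real n + 2)))
             - Re z * (ln ((real n + 3) / 2) - ln ((real n + 2) / 2)))"
      unfolding K_def distrib_right by (elim order_trans) (unfold exp_le_cancel_iff, linarith)
    also have "1 / ((real n + 1) * (real n + 2)) = 1 / (real n + 1) - 1 / (real n + 2)"
      by (simp add: field_simps)
    finally have step: "norm (1 - z / s) \<le> exp (K * (1 / (real n + 1) - 1 / (real n + 2))
             - Re z * (ln ((real n + 3) / 2) - ln ((real n + 2) / 2)))" .
    have "(\<Prod>j=1..Suc n. norm (1 - z / (\<zeta> + of_nat j))) =
            (\<Prod>j=1..n. norm (1 - z / (\<zeta> + of_nat j))) * norm (1 - z / s)"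
      by (simp add: s_def)
    also have "\<dots> \<le> exp (K * (1 - 1 / (real n + 1)) - Re z * ln ((real n + 2) / 2)) *
        exp (K * (1 / (real n + 1) - 1 / (real n + 2))
             - Re z * (ln ((real n + 3) / 2) - ln ((real n + 2) / 2)))"
      by (intro mult_mono Suc.IH step prod_nonneg) auto
    also have "\<dots> = exp (K * (1 - 1 / (real (Suc n) + 1)) - Re z * ln ((real (Suc n) + 2) / 2))"
      unfolding exp_add [symmetric] by (rule arg_cong[of _ _ exp]) (simp add: algebra_simps)
    finally show ?case .
  qed auto
  also have "\<dots> \<le> exp (K - Re z * ln ((real n + 2) / 2))"
    using K by (simp add: mult_left_le)
  also have "\<dots> = exp K * ((real n + 2) / 2) powr (- Re z)"
    by (simp add: powr_def exp_diff exp_minus field_simps)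
  finally show ?thesis
    unfolding K_def .
qed

text \<open>Up to sign the coefficient is the product of the factors 1 - (w+1)/j, so this is the
  product bound with shift 0 and \<open>\<delta>\<close> = 1.\<close>

lemma norm_gbinomial_le:
  fixes w :: complex
  assumes "Re w \<ge> -1"
  shows "norm (w gchoose n) \<le> exp (norm (w + 1) ^ 2 + norm (w + 1)) * ((real n + 2) / 2) powr (- (Re w + 1))"
proof -
  have "norm (w gchoose n) = (\<Prod>j=1..n. norm (1 - (w + 1) / (0 + of_nat j)))"
  proof (induction n)
    case (Suc n)
    have "(w gchoose Suc n) = (w gchoose n) * ((w - of_nat n) / of_nat (Suc n))"
      using gbinomial_absorption[of n w] gbinomial_absorb_comp[of w n]
      by (simp add: field_simps del: of_nat_Suc)
    moreover have "(w - of_nat n) / of_nat (Suc n) = - (1 - (w + 1) / of_nat (Suc n))"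
      by (simp add: divide_simps del: of_nat_Suc) (simp add: algebra_simps)
    ultimately show ?case
      using Suc by (simp only: norm_mult norm_minus_cancel) (simp del: of_nat_Suc)
  qed auto
  also have "\<dots> \<le> exp (norm (w + 1) ^ 2 / 1 ^ 2 + norm (w + 1) * norm (1 - 0 :: complex) / 1)
      * ((real n + 2) / 2) powr (- Re (w + 1))"
    using assms by (intro norm_prod_one_minus_divide_le) auto
  finally show ?thesis by simp
qed

lemma summable_shifted_powr:
  fixes p :: real
  assumes "p > 1"
  shows "summable (\<lambda>k. ((real k + 2) / 2) powr (- p))"
proof -
  have "summable (\<lambda>k. real (k + 2) powr (- p))"
    using assms by (subst summable_iff_shift) (simp add: summable_real_powr_iff)
  then have "summable (\<lambda>k. (1 / 2) powr (- p) * real (k + 2) powr (- p))"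
    by (rule summable_mult)
  then show ?thesis
    by (simp flip: powr_mult add: add_ac)
qed

text \<open>The constants \<open>c\<close>, \<open>A\<close> and \<open>Q\<close> make the bound
  uniform in \<open>w\<close> and \<open>q\<close> on compact sets, as the Weierstrass test
  requires. The condition on \<open>k\<close> yields |k + q| >= k - Q >= (k+2)/2, which contributes
  one more power of decay.\<close>

lemma norm_gbinomial_divide_le:
  fixes w q :: complex
  assumes c: "0 \<le> c" "c \<le> Re w + 1" and w: "norm (w + 1) \<le> A"
    and q: "norm q \<le> Q" and k: "real k \<ge> 2 * Q + 2"
  shows "norm ((w gchoose k) / (of_nat k + q)) \<le> exp (A ^ 2 + A) * ((real k + 2) / 2) powr (- (c + 1))"
proof -
  have "norm (w gchoose k) \<le> exp (norm (w + 1) ^ 2 + norm (w + 1)) * ((real k + 2) / 2) powr (- (Re w + 1))"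
    using c by (intro norm_gbinomial_le) auto
  also have "\<dots> \<le> exp (A ^ 2 + A) * ((real k + 2) / 2) powr (- c)"
    using c w power_mono[OF w norm_ge_zero, of 2] by (intro mult_mono powr_mono) auto
  finally have 1: "norm (w gchoose k) \<le> exp (A ^ 2 + A) * ((real k + 2) / 2) powr (- c)" .
  have "real k \<le> norm (of_nat k + q) + norm q"
    using norm_triangle_ineq4[of "of_nat k + q" q] by simp
  then have 2: "(real k + 2) / 2 \<le> norm (of_nat k + q)"
    using q k by simp
  have "norm ((w gchoose k) / (of_nat k + q)) =
          norm (w gchoose k) / norm (of_nat k + q)"
    by (simp add: norm_divide)
  also have "\<dots> \<le> (exp (A ^ 2 + A) * ((real k + 2) / 2) powr (- c)) / ((real k + 2) / 2)"
    using 1 2 by (intro frac_le) auto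
  also have "\<dots> = exp (A ^ 2 + A) * ((real k + 2) / 2) powr (- (c + 1))"
    using powr_diff[of "(real k + 2) / 2" "- c" 1] by simp
  finally show ?thesis .
qed

lemma summable_norm_gbinomial_divide:
  fixes w q :: complex
  assumes "Re w > -1"
  shows "summable (\<lambda>k. norm ((w gchoose k) / (of_nat k + q)))"
proof (rule summable_comparison_test_ev)
  define N where "N = nat \<lceil>2 * norm q + 2\<rceil>"
  have "norm (norm ((w gchoose k) / (of_nat k + q)))
          \<le> exp (norm (w + 1) ^ 2 + norm (w + 1)) * ((real k + 2) / 2) powr (- (Re w + 1 + 1))" if "k \<ge> N" for k
  proof -
    have "2 * norm q + 2 \<le> real k"
      using that unfolding N_def by linarith
    then show ?thesis
      using assms norm_gbinomial_divide_le[of "Re w + 1" w "norm (w + 1)" q "norm q" k] by simp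
  qed
  then show "\<forall>\<^sub>F k in sequentially. norm (norm ((w gchoose k) / (of_nat k + q)))
          \<le> exp (norm (w + 1) ^ 2 + norm (w + 1)) * ((real k + 2) / 2) powr (- (Re w + 1 + 1))"
    using eventually_sequentially by blast
  show "summable (\<lambda>k. exp (norm (w + 1) ^ 2 + norm (w + 1)) * ((real k + 2) / 2) powr (- (Re w + 1 + 1)))"
    using assms by (intro summable_mult summable_shifted_powr) auto
qed

text \<open>Partial sums converge locally uniformly. Letting both \<open>f\<close> and
  \<open>g\<close> vary covers holomorphy in the upper parameter and in the pole at once, while
  \<open>e\<close> admits the plain as well as the alternating series.\<close>

lemma holomorphic_suminf_gbinomial_divide:
  fixes f g :: "complex \<Rightarrow> complex"
  assumes S: "open S" and f: "f holomorphic_on S" and g: "g holomorphic_on S"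
    and Re_f: "\<And>z. z \<in> S \<Longrightarrow> Re (f z) > -1"
    and g_nonpos: "\<And>z. z \<in> S \<Longrightarrow> g z \<notin> \<int>\<^sub>\<le>\<^sub>0"
    and e: "\<And>k. norm (e k) \<le> 1"
  shows "(\<lambda>z. \<Sum>k. e k * ((f z gchoose k) / (of_nat k + g z))) holomorphic_on S"
proof (rule holomorphic_uniform_sequence[OF S])
  have nz: "of_nat k + g z \<noteq> 0" if "z \<in> S" for z k
    by (intro add_of_nat_nonzero g_nonpos that)
  show "(\<lambda>z. \<Sum>k<n. e k * ((f z gchoose k) / (of_nat k + g z))) holomorphic_on S" for n
    unfolding gbinomial_prod_rev using nz by (intro holomorphic_intros f g) auto
  fix x assume x: "x \<in> S"
  obtain d where d: "d > 0" "cball x d \<subseteq> S"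
    using S x open_contains_cball by blast
  have contf: "continuous_on (cball x d) f" and contg: "continuous_on (cball x d) g"
    using f g d holomorphic_on_imp_continuous_on holomorphic_on_subset by blast+
  have "compact ((\<lambda>z. Re (f z)) ` cball x d)"
    by (intro compact_continuous_image continuous_intros contf) auto
  then obtain z0 where z0: "z0 \<in> cball x d" "\<And>z. z \<in> cball x d \<Longrightarrow> Re (f z0) \<le> Re (f z)"
    using d continuous_attains_inf[of "cball x d" "\<lambda>z. Re (f z)"] contf
    by (metis cball_eq_empty compact_cball continuous_on_Re not_less_iff_gr_or_eq)
  \<comment> \<open>By compactness Re f + 1 has a positive minimum on the disc, so the majorant has
    exponent c + 1 > 1.\<close>
  define c where "c = Re (f z0) + 1"
  have c: "c > 0" "\<And>z. z \<in> cball x d \<Longrightarrow> c \<le> Re (f z) + 1"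
    using z0 d Re_f[of z0] by (auto simp: c_def)
  have "bounded ((\<lambda>z. f z + 1) ` cball x d)" "bounded (g ` cball x d)"
    by (intro compact_imp_bounded compact_continuous_image continuous_intros contf contg compact_cball)+
  then obtain A Q where A: "\<And>z. z \<in> cball x d \<Longrightarrow> norm (f z + 1) \<le> A"
    and Q: "\<And>z. z \<in> cball x d \<Longrightarrow> norm (g z) \<le> Q"
    unfolding bounded_iff by blast
  have "uniform_limit (cball x d) (\<lambda>n z. \<Sum>k<n. e k * ((f z gchoose k) / (of_nat k + g z)))
          (\<lambda>z. \<Sum>k. e k * ((f z gchoose k) / (of_nat k + g z))) sequentially"
  proof (rule Weierstrass_m_test_ev)
    have "\<forall>z\<in>cball x d. norm (e k * ((f z gchoose k) / (of_nat k + g z)))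
            \<le> exp (A ^ 2 + A) * ((real k + 2) / 2) powr (- (c + 1))"
      if "k \<ge> nat \<lceil>2 * Q + 2\<rceil>" for k
    proof
      fix z assume z: "z \<in> cball x d"
      have "norm (e k * ((f z gchoose k) / (of_nat k + g z))) \<le>
              norm ((f z gchoose k) / (of_nat k + g z))"
        unfolding norm_mult using e[of k] by (intro mult_left_le_one_le) auto
      also have "\<dots> \<le> exp (A ^ 2 + A) * ((real k + 2) / 2) powr (- (c + 1))"
        using that c(1) c(2)[OF z] A[OF z] Q[OF z]
        by (intro norm_gbinomial_divide_le[where Q = Q]) linarith+
      finally show "norm (e k * ((f z gchoose k) / (of_nat k + g z)))
            \<le> exp (A ^ 2 + A) * ((real k + 2) / 2) powr (- (c + 1))" .
    qed
    then show "\<forall>\<^sub>F k in sequentially. \<forall>z\<in>cball x d. norm (e k * ((f z gchoose k) / (of_nat k + g z)))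
            \<le> exp (A ^ 2 + A) * ((real k + 2) / 2) powr (- (c + 1))"
      using eventually_sequentially by blast
    show "summable (\<lambda>k. exp (A ^ 2 + A) * ((real k + 2) / 2) powr (- (c + 1)))"
      using c by (intro summable_mult summable_shifted_powr) auto
  qed
  then show "\<exists>d>0. cball x d \<subseteq> S \<and> uniform_limit (cball x d)
      (\<lambda>n z. \<Sum>k<n. e k * ((f z gchoose k) / (of_nat k + g z)))
      (\<lambda>z. \<Sum>k. e k * ((f z gchoose k) / (of_nat k + g z))) sequentially"
    using d by blast
qed

section \<open>The beta function as a binomial series\<close>

text \<open>Identity theorem: the points 2 + 1/(n+1) lie on the real ray and accumulate at 2, inside
  the connected domain.\<close>

lemma holomorphic_eqI_of_real:
  fixes f g :: "complex \<Rightarrow> complex"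
  assumes "f holomorphic_on S" "g holomorphic_on S" "open S" "connected S"
    and real: "\<And>x::real. x > 1 \<Longrightarrow> of_real x \<in> S"
    and eq: "\<And>x::real. x > 1 \<Longrightarrow> f (of_real x) = g (of_real x)"
    and "z \<in> S"
  shows "f z = g z"
proof -
  have "f z - g z = 0"
  proof (rule analytic_continuation[where f = "\<lambda>z. f z - g z" and w = z and U = "of_real ` {1<..}"])
    have "(\<lambda>n. 2 + 1 / of_nat (Suc n) :: complex) \<longlonglongrightarrow> 2 + 0"
      by (intro tendsto_intros lim_1_over_n LIMSEQ_Suc)
    moreover have "2 + 1 / of_nat (Suc n) \<in> complex_of_real ` {1<..} - {2}" for n
      by (auto intro!: image_eqI[of _ _ "2 + 1 / real (Suc n)"] simp del: of_nat_Suc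
            simp: add_pos_nonneg)
    ultimately show "2 islimpt complex_of_real ` {1<..}"
      unfolding islimpt_sequential by (intro exI[of _ "\<lambda>n. 2 + 1 / of_nat (Suc n)"]) simp
    show "2 \<in> S"
      using real[of 2] by simp
  qed (use assms in \<open>auto intro!: holomorphic_intros\<close>)
  then show ?thesis by simp
qed

text \<open>The factor (1 - t)^w in Euler's integral for the beta function is expanded binomially.
  For w > 0 the coefficients are absolutely summable, so the series converges uniformly on [0,1]; q
  > 1 makes the terms continuous at 0.\<close>

lemma suminf_gbinomial_eq_Beta_real:
  fixes w q :: real
  assumes w: "w > 0" and q: "q > 1"
  shows "(\<Sum>k. (- 1) ^ k * ((of_real w gchoose k) / (of_nat k + of_real q))) =
           Beta (of_real w + 1) (of_real q :: complex)"
proof -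
  define c :: "nat \<Rightarrow> complex" where "c = (\<lambda>k. (- 1) ^ k * (of_real w gchoose k))"
  define f where "f = (\<lambda>n (t::real). \<Sum>k<n. c k * of_real (t ^ k * t powr (q - 1)))"
  define g where "g = (\<lambda>t::real. \<Sum>k. c k * of_real (t ^ k * t powr (q - 1)))"
  have "uniform_limit {0..1} f g sequentially"
    unfolding f_def g_def
  proof (rule Weierstrass_m_test)
    show "norm (c k * of_real (t ^ k * t powr (q - 1)))
            \<le> exp (norm (of_real w + 1 :: complex) ^ 2 + norm (of_real w + 1 :: complex)) * ((real k + 2) / 2) powr (- (w + 1))"
      if "t \<in> {0..1}" for k and t :: real
    proof -
      have "norm (c k * of_real (t ^ k * t powr (q - 1))) \<le>
              norm (complex_of_real w gchoose k) * (1 * 1)"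
        unfolding c_def norm_mult norm_power norm_of_real abs_mult using that q
        by (intro mult_mono) (auto intro: power_le_one powr_le1)
      also have "\<dots> \<le> exp (norm (of_real w + 1 :: complex) ^ 2 + norm (of_real w + 1 :: complex)) * ((real k + 2) / 2) powr (- (w + 1))"
        using norm_gbinomial_le[of "of_real w" k] w by simp
      finally show ?thesis .
    qed
    show "summable (\<lambda>k. exp (norm (of_real w + 1 :: complex) ^ 2 + norm (of_real w + 1 :: complex)) * ((real k + 2) / 2) powr (- (w + 1)))"
      using w by (intro summable_mult summable_shifted_powr) auto
  qed
  moreover have "continuous_on {0..1} (f n)" for n
    unfolding f_def using q by (intro continuous_intros continuous_on_powr') auto
  ultimately obtain I J where I: "\<And>n. (f n has_integral I n) {0..1}"
    and J: "(g has_integral J) {0..1}" and lim: "I \<longlonglongrightarrow> J"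
    by (rule uniform_limit_integral) auto
  have "I = (\<lambda>n. \<Sum>k<n. c k * (1 / (of_nat k + of_real q)))"
  proof (intro ext has_integral_unique[OF I])
    fix n
    have "((\<lambda>t. t ^ k * t powr (q - 1)) has_integral 1 / (real k + q)) {0..1}" for k
    proof (rule has_integral_spike_finite)
      show "((\<lambda>t. t powr (real k + q - 1)) has_integral 1 / (real k + q)) {0..1}"
        using has_integral_powr_from_0[of "real k + q - 1" 1] q by simp
      show "t ^ k * t powr (q - 1) = t powr (real k + q - 1)" if "t \<in> {0..1} - {0}" for t
        using that by (simp flip: powr_realpow powr_add add: algebra_simps)
    qed auto
    then have "((\<lambda>t. complex_of_real (t ^ k * t powr (q - 1))) has_integral of_real (1 / (real k + q))) {0..1}" for k
      by (rule has_integral_of_real)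
    then show "(f n has_integral (\<Sum>k<n. c k * (1 / (of_nat k + of_real q)))) {0..1}"
      unfolding f_def by (intro has_integral_sum has_integral_mult_right) auto
  qed
  with lim have sums: "(\<lambda>k. c k * (1 / (of_nat k + of_real q))) sums J"
    unfolding sums_def by simp
  \<comment> \<open>The binomial theorem needs t < 1, hence the single exceptional point t =
    1.\<close>
  have "(g has_integral of_real (Beta q (w + 1))) {0..1}"
  proof (rule has_integral_spike_finite)
    show "((\<lambda>t. complex_of_real (t powr (q - 1) * (1 - t) powr (w + 1 - 1)))
            has_integral of_real (Beta q (w + 1))) {0..1}"
      using q w by (intro has_integral_of_real has_integral_Beta_real) auto
    show "g t = complex_of_real (t powr (q - 1) * (1 - t) powr (w + 1 - 1))" if "t \<in> {0..1} - {1}" for t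
    proof -
      have "(\<lambda>k. (of_real w gchoose k) * (- of_real t) ^ k) sums (1 + - complex_of_real t) powr of_real w"
        using that by (intro gen_binomial_complex) auto
      from sums_mult2[OF this, of "of_real (t powr (q - 1))"]
      have "(\<lambda>k. c k * of_real (t ^ k * t powr (q - 1))) sums
              ((1 + - complex_of_real t) powr of_real w * of_real (t powr (q - 1)))"
        by (simp add: c_def power_minus[of "of_real t"] mult_ac)
      moreover have "(1 + - complex_of_real t) powr of_real w = of_real ((1 - t) powr w)"
        using that powr_of_real[of "1 - t" w] by simp
      ultimately show ?thesis
        by (simp add: g_def sums_iff)
    qed
  qed auto
  then have "J = of_real (Beta q (w + 1))"
    using J has_integral_unique by blast
  then show ?thesis
    using sums by (simp add: c_def sums_iff Beta_commute flip: Beta_complex_of_real)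
qed

text \<open>Two analytic continuations from the real case: first in \<open>q\<close> over the
  complement of the nonpositive integers, connected because only countably many points are removed,
  then in \<open>w\<close> over the half-plane Re w > -1.\<close>

lemma suminf_gbinomial_eq_Beta:
  fixes w q :: complex
  assumes w: "Re w > -1" and q: "q \<notin> \<int>\<^sub>\<le>\<^sub>0"
  shows "(\<Sum>k. (- 1) ^ k * ((w gchoose k) / (of_nat k + q))) = Beta (w + 1) q"
proof -
  have real: "(\<Sum>k. (- 1) ^ k * ((of_real u gchoose k) / (of_nat k + q))) = Beta (of_real u + 1) q"
    if u: "u > 1" for u :: real
  proof (rule holomorphic_eqI_of_real[where S = "UNIV - \<int>\<^sub>\<le>\<^sub>0" and g = "Beta (of_real u + 1)"
        and f = "\<lambda>z. \<Sum>k. (- 1) ^ k * ((of_real u gchoose k) / (of_nat k + z))"])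
    show "(\<lambda>z. \<Sum>k. (- 1) ^ k * ((of_real u gchoose k) / (of_nat k + z))) holomorphic_on UNIV - \<int>\<^sub>\<le>\<^sub>0"
      using u by (intro holomorphic_suminf_gbinomial_divide holomorphic_intros)
        (auto simp: norm_power open_Diff)
    show "Beta (of_real u + 1) holomorphic_on UNIV - \<int>\<^sub>\<le>\<^sub>0"
      using add_one_notin_nonpos_Ints[of "of_real u"] u by (intro holomorphic_intros) auto
    show "connected (UNIV - \<int>\<^sub>\<le>\<^sub>0 :: complex set)"
      by (intro connected_open_diff_countable)
        (auto simp: connected_UNIV intro: countable_subset[OF _ countable_int] elim: nonpos_Ints_cases)
    show "complex_of_real x \<in> UNIV - \<int>\<^sub>\<le>\<^sub>0" if "x > 1" for x
      using that by (auto elim!: nonpos_Ints_cases simp: complex_eq_iff)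
    show "(\<Sum>k. (- 1) ^ k * ((of_real u gchoose k) / (of_nat k + of_real x))) = Beta (of_real u + 1) (complex_of_real x)"
      if "x > 1" for x
      using that u by (intro suminf_gbinomial_eq_Beta_real) auto
  qed (use q in auto)
  show ?thesis
  proof (rule holomorphic_eqI_of_real[where S = "{z. Re z > -1}" and g = "\<lambda>z. Beta (z + 1) q"
        and f = "\<lambda>z. \<Sum>k. (- 1) ^ k * ((z gchoose k) / (of_nat k + q))"])
    show "(\<lambda>z. \<Sum>k. (- 1) ^ k * ((z gchoose k) / (of_nat k + q))) holomorphic_on {z. Re z > -1}"
      using q by (intro holomorphic_suminf_gbinomial_divide holomorphic_intros)
        (auto simp: norm_power open_halfspace_Re_gt)
    show "(\<lambda>z. Beta (z + 1) q) holomorphic_on {z. Re z > -1}"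
      using add_one_notin_nonpos_Ints q by (intro holomorphic_intros) auto
  qed (use w real in \<open>auto simp: open_halfspace_Re_gt intro: convex_connected convex_halfspace_Re_gt\<close>)
qed

section \<open>Termwise integration over the unit circle\<close>

text \<open>Cosine is concave on [0, pi/2] and hence lies above the chord from (0,1) to
  (pi/2,0).\<close>

lemma cos_half_ge:
  fixes t :: real
  assumes "\<bar>t\<bar> \<le> pi"
  shows "cos (t / 2) \<ge> 1 - \<bar>t\<bar> / pi"
proof -
  have "convex_on {0..pi / 2} (\<lambda>x. - cos x)"
  proof (rule f''_ge0_imp_convex)
    show "((\<lambda>x. - cos x) has_real_derivative sin x) (at x)"
      "(sin has_real_derivative cos x) (at x)" for x :: real
      by (auto intro!: derivative_eq_intros)
  qed (auto intro: cos_ge_zero)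
  from convex_onD_Icc''[OF this, of "\<bar>t\<bar> / 2"] assms
  have "- cos (\<bar>t\<bar> / 2) \<le> - (2 / pi) * (pi / 2 - \<bar>t\<bar> / 2)"
    by simp
  also have "\<dots> = - (1 - \<bar>t\<bar> / pi)"
    by (simp add: field_simps)
  finally show ?thesis
    by (cases "t \<ge> 0") auto
qed

text \<open>Two lower bounds are averaged: the norm is at least 1 - r, and, by comparison with r =
  1, at least 2 cos(t/2) - (1 - r). Their sum no longer contains r.\<close>

lemma norm_one_plus_scaled_cis_ge:
  assumes "0 \<le> r" "r \<le> 1" "\<bar>t\<bar> \<le> pi"
  shows "norm (1 + of_real r * cis t) \<ge> 1 - \<bar>t\<bar> / pi"
proof -
  have "norm (1 + cis t) ^ 2 = (2 * cos (t / 2)) ^ 2"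
  proof -
    have "norm (1 + cis t) ^ 2 = 2 + 2 * cos t"
      using sin_cos_squared_add[of t] unfolding cmod_power2 by (simp add: power2_sum)
    also have "cos t = 2 * cos (t / 2) ^ 2 - 1"
      using cos_double_cos[of "t / 2"] by simp
    finally show ?thesis by (simp add: power2_eq_square)
  qed
  then have 1: "norm (1 + cis t) = 2 * cos (t / 2)"
  proof (rule power2_eq_imp_eq)
    show "2 * cos (t / 2) \<ge> 0"
      using assms cos_ge_zero[of "t / 2"] by simp
  qed simp
  have 2: "norm (1 + of_real r * cis t) \<ge> 1 - r"
    using norm_triangle_ineq2[of 1 "- (of_real r * cis t)"] assms by (simp add: norm_mult)
  have "1 + cis t = (1 + of_real r * cis t) + of_real (1 - r) * cis t"
    by (simp add: algebra_simps)
  then have "norm (1 + cis t) \<le> norm (1 + of_real r * cis t) + norm (of_real (1 - r) * cis t)"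
    by (metis norm_triangle_ineq)
  moreover have "norm (of_real (1 - r) * cis t) = 1 - r"
    using assms unfolding norm_mult norm_of_real by simp
  ultimately show ?thesis
    using 1 2 cos_half_ge[OF assms(3)] by linarith
qed

text \<open>The boundary function of the binomial series on the circle of radius \<open>r\<close>,
  extended by 0 to the whole line. The open interval leaves out t = -pi and t = pi, where the base
  vanishes for r = 1.\<close>

definition arc_powr :: "real \<Rightarrow> complex \<Rightarrow> real \<Rightarrow> complex" where
  "arc_powr r w t = indicator {-pi<..<pi} t *\<^sub>R (1 + of_real r * cis t) powr w"

text \<open>
  For \<open>Re w < 0\<close> the singularities at \<open>t = \<plusminus>\<pi>\<close> have to be dominated uniformly in the radius; this is
  possible because \<open>\<bar>1 + r e\<^sup>i\<^sup>t\<bar> \<ge> 1 - \<bar>t\<bar>/\<pi>\<close> for all \<open>0 \<le> r \<le> 1\<close>.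
\<close>

definition arc_bound :: "complex \<Rightarrow> real \<Rightarrow> real" where
  "arc_bound w t = exp (pi * \<bar>Im w\<bar>) * (2 powr Re w * indicator {-pi<..<pi} t
     + (indicator {0..1} (1 + (1 / pi) * t) * (1 + (1 / pi) * t) powr Re w
        + indicator {0..1} (1 + (- 1 / pi) * t) * (1 + (- 1 / pi) * t) powr Re w))"

text \<open>The two singular summands are affine substitutions of x^(Re w) on [0,1], which is
  integrable there because Re w > -1.\<close>

lemma integrable_arc_bound:
  assumes "Re w > -1"
  shows "integrable lborel (arc_bound w)"
proof -
  have "set_integrable lebesgue {0..1} (\<lambda>x::real. x powr Re w)"
    using has_integral_powr_from_0[OF assms, of 1]
    by (intro nonnegative_absolutely_integrable_1) auto
  then have "integrable lborel (\<lambda>x::real. indicator {0..1} x * x powr Re w)"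
    unfolding set_integrable_def by (simp add: integrable_completion)
  note lborel_integrable_real_affine[OF this, of "1 / pi" 1] lborel_integrable_real_affine[OF this, of "- 1 / pi" 1]
  then show ?thesis
    unfolding arc_bound_def
    by (intro integrable_mult_right integrable_add integrable_real_indicator) auto
qed

text \<open>The imaginary part r sin t vanishes only for r = 0 or t = 0, and there the real part is
  at least 1. So the principal power is continuous along these arcs and as the radius tends to
  1.\<close>

lemma arc_notin_nonpos_Reals:
  assumes "0 \<le> r" "t \<in> {-pi<..<pi}"
  shows "1 + of_real r * cis t \<notin> \<real>\<^sub>\<le>\<^sub>0"
proof
  assume "1 + of_real r * cis t \<in> \<real>\<^sub>\<le>\<^sub>0"
  then have *: "r * sin t = 0" "1 + r * cos t \<le> 0"
    by (auto simp: complex_nonpos_Reals_iff)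
  then have "r = 0 \<or> t = 0"
    using assms sin_eq_0_pi[of t] by auto
  then show False
    using * assms by auto
qed

lemma borel_measurable_arc_powr [measurable]:
  assumes "0 \<le> r"
  shows "arc_powr r w \<in> borel_measurable borel"
proof -
  have "continuous_on {-pi<..<pi} (\<lambda>t. (1 + of_real r * cis t) powr w)"
  proof (rule continuous_on_powr_complex)
    show "{-pi<..<pi} \<subseteq> {t. Re (1 + of_real r * cis t) \<ge> 0 \<or> Im (1 + of_real r * cis t) \<noteq> 0}"
      using arc_notin_nonpos_Reals[OF assms] by (fastforce simp: complex_nonpos_Reals_iff)
    show "0 < Re w" if "t \<in> {-pi<..<pi}" "1 + of_real r * cis t = 0" for t
      using arc_notin_nonpos_Reals[OF assms that(1)] that(2) by simp
  qed (auto intro!: continuous_intros)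
  then show ?thesis
    unfolding arc_powr_def by (intro borel_measurable_continuous_on_indicator) auto
qed

text \<open>The argument of the base contributes at most the factor exp(pi |Im w|). For Re w >= 0
  the modulus is controlled by |z| <= 2, otherwise by the lower bound 1 - |t|/pi.\<close>

lemma norm_arc_powr_le:
  assumes "0 \<le> r" "r \<le> 1"
  shows "norm (arc_powr r w t) \<le> arc_bound w t"
proof (cases "t \<in> {-pi<..<pi}")
  case True
  define z where "z = 1 + of_real r * cis t"
  have lower: "norm z \<ge> 1 - \<bar>t\<bar> / pi"
    using norm_one_plus_scaled_cis_ge assms True unfolding z_def by auto
  have pos: "1 - \<bar>t\<bar> / pi > 0"
    using True by (auto simp: field_simps)
  have upper: "norm z \<le> 2"
    using norm_triangle_ineq[of 1 "of_real r * cis t"] assms unfolding z_def by (simp add: norm_mult)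
  have "norm z powr Re w \<le> 2 powr Re w + (1 - \<bar>t\<bar> / pi) powr Re w"
  proof (cases "Re w \<ge> 0")
    case True
    then have "norm z powr Re w \<le> 2 powr Re w"
      using upper by (intro powr_mono2) auto
    then show ?thesis by (simp add: add_increasing2)
  next
    case False
    then have "norm z powr Re w \<le> (1 - \<bar>t\<bar> / pi) powr Re w"
      using lower pos by (intro powr_mono2') auto
    then show ?thesis by (simp add: add_increasing)
  qed
  \<comment> \<open>The sign of \<open>t\<close> decides which of the two summands equals the left
    side; the other one is nonnegative.\<close>
  also have "(1 - \<bar>t\<bar> / pi) powr Re w \<le>
      indicator {0..1} (1 + (1 / pi) * t) * (1 + (1 / pi) * t) powr Re w
        + indicator {0..1} (1 + (- 1 / pi) * t) * (1 + (- 1 / pi) * t) powr Re w"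
  proof (cases "t \<ge> 0")
    case True
    then have "indicator {0..1} (1 + (- 1 / pi) * t) = (1::real)"
      using pos by (auto simp: indicator_def)
    then show ?thesis
      using True by simp
  next
    case False
    then have "indicator {0..1} (1 + (1 / pi) * t) = (1::real)"
      using pos by (auto simp: indicator_def divide_nonpos_pos)
    then show ?thesis
      using False by simp
  qed
  finally have 1: "norm z powr Re w \<le> 2 powr Re w + \<dots>" by simp
  have "norm (z powr w) = exp (- Im w * Arg z) * norm z powr Re w"
    by (simp add: norm_powr_complex)
  also have "- Im w * Arg z \<le> pi * \<bar>Im w\<bar>"
  proof -
    have "- Im w * Arg z \<le> \<bar>Im w\<bar> * \<bar>Arg z\<bar>"
      using abs_ge_self[of "- Im w * Arg z"] by (simp add: abs_mult)
    also have "\<dots> \<le> \<bar>Im w\<bar> * pi"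
      using Arg_bounded[of z] by (intro mult_left_mono) auto
    finally show ?thesis by (simp add: mult.commute)
  qed
  finally have "norm (z powr w) \<le> exp (pi * \<bar>Im w\<bar>) * norm z powr Re w"
    by (simp add: mult_right_mono)
  also have "\<dots> \<le> arc_bound w t"
    unfolding arc_bound_def using 1 True by (intro mult_left_mono) auto
  finally show ?thesis
    using True by (simp add: arc_powr_def z_def)
qed (auto simp: arc_powr_def arc_bound_def)

lemma integrable_arc_powr:
  assumes "Re w > -1"
  shows "integrable lborel (arc_powr 1 w)"
proof (rule Bochner_Integration.integrable_bound[OF integrable_arc_bound[OF assms]])
  have "norm (arc_powr 1 w t) \<le> norm (arc_bound w t)" for t
    using norm_arc_powr_le[of 1 w t] by simp
  then show "AE t in lborel. norm (arc_powr 1 w t) \<le> norm (arc_bound w t)"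
    by simp
qed auto

lemma integral_exp_open_interval:
  fixes p :: complex
  assumes "p \<noteq> 0" "a \<le> b"
  shows "(LINT t|lborel. indicator {a<..<b} t *\<^sub>R exp (\<i> * p * of_real t)) =
           (exp (\<i> * p * of_real b) - exp (\<i> * p * of_real a)) / (\<i> * p)"
proof -
  have "(LINT t|lborel. indicator {a<..<b} t *\<^sub>R exp (\<i> * p * of_real t)) =
          (LINT t|lborel. indicator {a..b} t *\<^sub>R exp (\<i> * p * of_real t))"
    by (rule integral_discrete_difference[where X = "{a, b}"]) (auto simp: indicator_def)
  also have "\<dots> = exp (\<i> * p * of_real b) / (\<i> * p) - exp (\<i> * p * of_real a) / (\<i> * p)"
    using assms
    by (intro integral_FTC_atLeastAtMost has_vector_derivative_real_field continuous_intros)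
      (auto intro!: derivative_eq_intros)
  finally show ?thesis by (simp add: diff_divide_distrib)
qed

lemma integral_sums_pointwise:
  fixes f :: "nat \<Rightarrow> 'a \<Rightarrow> 'b :: {banach, second_countable_topology}"
  assumes "\<And>k. integrable M (f k)" "\<And>x. summable (\<lambda>k. norm (f k x))"
    and "summable (\<lambda>k. LINT x|M. norm (f k x))" "\<And>x. (\<lambda>k. f k x) sums g x"
  shows "(\<lambda>k. integral\<^sup>L M (f k)) sums integral\<^sup>L M g"
proof -
  have "g = (\<lambda>x. \<Sum>k. f k x)"
    using assms(4) by (simp add: fun_eq_iff sums_iff)
  then show ?thesis
    using sums_integral[of M f] assms by auto
qed

text \<open>Inside the unit disc the coefficients are bounded and the powers r^k decay
  geometrically, so summation and integration may be interchanged.\<close>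

lemma integral_arc_powr_scaled:
  fixes w q :: complex
  assumes w: "Re w > -1" and q: "q \<notin> \<int>\<^sub>\<le>\<^sub>0" and r: "0 \<le> r" "r < 1"
    and ab: "- pi \<le> a" "a \<le> b" "b \<le> pi"
  shows "(LINT t|lborel. indicator {a<..<b} t *\<^sub>R (arc_powr r w t * exp (\<i> * q * of_real t))) =
           (\<Sum>k. of_real (r ^ k) * ((w gchoose k) / (of_nat k + q)
              * ((exp (\<i> * (of_nat k + q) * of_real b) - exp (\<i> * (of_nat k + q) * of_real a)) / \<i>)))"
proof -
  define f where "f = (\<lambda>k t. indicator {a<..<b} t *\<^sub>R
    ((w gchoose k) * of_real (r ^ k) * exp (\<i> * (of_nat k + q) * of_real t)))"
  define C where "C = exp (norm (w + 1) ^ 2 + norm (w + 1))"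
  have gbound: "norm (w gchoose k) \<le> C" for k
  proof -
    have "norm (w gchoose k) \<le> C * ((real k + 2) / 2) powr (- (Re w + 1))"
      unfolding C_def using w by (intro norm_gbinomial_le) auto
    also have "\<dots> \<le> C * 1"
      using w powr_mono[of "- (Re w + 1)" 0 "(real k + 2) / 2"]
      by (intro mult_left_mono) (auto simp: C_def)
    finally show ?thesis by simp
  qed
  have fbound: "norm (f k t) \<le> C * exp (\<bar>Im q\<bar> * pi) * r ^ k * indicator {a<..<b} t" for k t
  proof (cases "t \<in> {a<..<b}")
    case True
    have "norm (exp (\<i> * (of_nat k + q) * of_real t)) = exp (- Im q * t)"
      by (simp add: norm_exp_eq_Re)
    also have "- Im q * t \<le> \<bar>Im q\<bar> * \<bar>t\<bar>"
      using abs_ge_self[of "- Im q * t"] by (simp add: abs_mult)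
    also have "\<dots> \<le> \<bar>Im q\<bar> * pi"
      using True ab by (intro mult_left_mono) auto
    finally have "norm (exp (\<i> * (of_nat k + q) * of_real t)) \<le> exp (\<bar>Im q\<bar> * pi)"
      by simp
    then have "norm (f k t) \<le> C * r ^ k * exp (\<bar>Im q\<bar> * pi)"
      unfolding f_def norm_scaleR norm_mult using True r gbound[of k] order_trans[OF norm_ge_zero gbound[of k]]
      by (auto simp: norm_power intro!: mult_mono)
    then show ?thesis
      using True by (simp add: mult_ac)
  qed (auto simp: f_def)
  have meas: "f k \<in> borel_measurable lborel" for k
    unfolding f_def by measurable
  have int_dom: "integrable lborel (\<lambda>t. C * exp (\<bar>Im q\<bar> * pi) * r ^ k * indicator {a<..<b} t)" for k
    using ab by (intro integrable_mult_right integrable_real_indicator) auto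
  have int: "integrable lborel (f k)" for k
    by (rule Bochner_Integration.integrable_bound[OF int_dom[of k] meas])
      (use fbound[of k] in \<open>auto intro!: AE_I2 simp: C_def r split: split_indicator_asm\<close>)
  have "(\<lambda>k. integral\<^sup>L lborel (f k)) sums
      (LINT t|lborel. indicator {a<..<b} t *\<^sub>R (arc_powr r w t * exp (\<i> * q * of_real t)))"
  proof (rule integral_sums_pointwise[OF int])
    have geom: "summable (\<lambda>k. c * r ^ k)" for c :: real
      using r by (intro summable_mult summable_geometric) auto
    show "summable (\<lambda>k. norm (f k t))" for t
      by (rule summable_comparison_test'[OF geom[of "C * exp (\<bar>Im q\<bar> * pi) * indicator {a<..<b} t"], where N = 0])
        (use fbound[of _ t] in \<open>auto simp: mult_ac\<close>)
    show "summable (\<lambda>k. LINT t|lborel. norm (f k t))"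
    proof (rule summable_comparison_test'[OF geom[of "C * exp (\<bar>Im q\<bar> * pi) * (b - a)"], where N = 0])
      fix k
      have "(LINT t|lborel. norm (f k t)) \<le> (LINT t|lborel. C * exp (\<bar>Im q\<bar> * pi) * r ^ k * indicator {a<..<b} t)"
        using fbound by (intro integral_mono integrable_norm int int_dom) auto
      also have "\<dots> = C * exp (\<bar>Im q\<bar> * pi) * (b - a) * r ^ k"
        using ab by (simp add: mult_ac)
      finally show "norm (LINT t|lborel. norm (f k t)) \<le> C * exp (\<bar>Im q\<bar> * pi) * (b - a) * r ^ k"
        by simp
    qed
    show "(\<lambda>k. f k t) sums (indicator {a<..<b} t *\<^sub>R (arc_powr r w t * exp (\<i> * q * of_real t)))" for t
    proof (cases "t \<in> {a<..<b}")
      case True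
      have "(\<lambda>k. (w gchoose k) * (of_real r * cis t) ^ k) sums (1 + of_real r * cis t) powr w"
        using r by (intro gen_binomial_complex) (auto simp: norm_mult)
      from sums_mult2[OF this, of "exp (\<i> * q * of_real t)"]
      have "(\<lambda>k. (w gchoose k) * of_real (r ^ k) * exp (\<i> * (of_nat k + q) * of_real t)) sums
              ((1 + of_real r * cis t) powr w * exp (\<i> * q * of_real t))"
        by (simp add: power_mult_distrib cis_conv_exp mult_ac ring_distribs exp_add
            flip: exp_of_nat_mult)
      then show ?thesis
        using True ab by (simp add: f_def arc_powr_def)
    qed (auto simp: f_def)
  qed
  moreover have "integral\<^sup>L lborel (f k) = of_real (r ^ k) * ((w gchoose k) / (of_nat k + q)
      * ((exp (\<i> * (of_nat k + q) * of_real b) - exp (\<i> * (of_nat k + q) * of_real a)) / \<i>))" for k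
  proof -
    have nz: "of_nat k + q \<noteq> 0"
      by (rule add_of_nat_nonzero[OF q])
    have "f k = (\<lambda>t. (w gchoose k) * of_real (r ^ k) *
             (indicator {a<..<b} t *\<^sub>R exp (\<i> * (of_nat k + q) * of_real t)))"
      unfolding f_def by (simp add: fun_eq_iff)
    then have "integral\<^sup>L lborel (f k) = (w gchoose k) * of_real (r ^ k) *
           (LINT t|lborel. indicator {a<..<b} t *\<^sub>R exp (\<i> * (of_nat k + q) * of_real t))"
      by (simp only: integral_mult_right_zero)
    then show ?thesis
      unfolding integral_exp_open_interval[OF nz ab(2)]
      by (simp only: divide_inverse inverse_mult_distrib mult_ac)
  qed
  ultimately show ?thesis
    by (simp add: sums_iff)
qed

text \<open>The limit r -> 1 of the previous formula: dominated convergence with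
  \<open>arc_bound\<close> on the left, Tannery's theorem on the right. Division by k + q makes the
  series on the right absolutely convergent.\<close>

lemma integral_arc_powr:
  fixes w q :: complex
  assumes w: "Re w > -1" and q: "q \<notin> \<int>\<^sub>\<le>\<^sub>0"
    and ab: "- pi \<le> a" "a \<le> b" "b \<le> pi"
  shows "(LINT t|lborel. indicator {a<..<b} t *\<^sub>R (arc_powr 1 w t * exp (\<i> * q * of_real t))) =
           (\<Sum>k. (w gchoose k) / (of_nat k + q)
              * ((exp (\<i> * (of_nat k + q) * of_real b) - exp (\<i> * (of_nat k + q) * of_real a)) / \<i>))"
    (is "?I 1 = suminf ?c")
proof -
  define r where "r = (\<lambda>n. 1 - 1 / real (Suc n))"
  have r: "0 \<le> r n" "r n < 1" for n
    by (auto simp: r_def)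
  have r_lim: "r \<longlonglongrightarrow> 1"
    unfolding r_def using tendsto_diff[OF tendsto_const LIMSEQ_Suc[OF lim_1_over_n], of 1] by simp
  define E where "E = exp (\<bar>Im q\<bar> * pi)"
  have E: "norm (exp (\<i> * (of_nat k + q) * of_real t)) \<le> E" if "\<bar>t\<bar> \<le> pi" for k t
  proof -
    have "norm (exp (\<i> * (of_nat k + q) * of_real t)) = exp (- Im q * t)"
      by (simp add: norm_exp_eq_Re)
    also have "- Im q * t \<le> \<bar>Im q\<bar> * \<bar>t\<bar>"
      using abs_ge_self[of "- Im q * t"] by (simp add: abs_mult)
    also have "\<dots> \<le> \<bar>Im q\<bar> * pi"
      using that by (intro mult_left_mono) auto
    finally show ?thesis by (simp add: E_def)
  qed
  \<comment> \<open>Abel summation: the binomial series need not converge absolutely on the unit circle itself.\<close>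
  have "(\<lambda>n. ?I (r n)) \<longlonglongrightarrow> ?I 1"
  proof (rule integral_dominated_convergence)
    show "integrable lborel (\<lambda>t. E * arc_bound w t)"
      using integrable_arc_bound[OF w] by simp
    show "AE t in lborel. (\<lambda>n. indicator {a<..<b} t *\<^sub>R (arc_powr (r n) w t * exp (\<i> * q * of_real t)))
        \<longlonglongrightarrow> indicator {a<..<b} t *\<^sub>R (arc_powr 1 w t * exp (\<i> * q * of_real t))"
    proof (rule AE_I2)
      fix t :: real
      have "(\<lambda>n. arc_powr (r n) w t) \<longlonglongrightarrow> arc_powr 1 w t"
      proof (cases "t \<in> {-pi<..<pi}")
        case True
        have "1 + of_real 1 * cis t \<notin> \<real>\<^sub>\<le>\<^sub>0"
          using arc_notin_nonpos_Reals[OF _ True, of 1] by simp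
        then show ?thesis
          unfolding arc_powr_def by (intro tendsto_intros r_lim) auto
      qed (simp add: arc_powr_def)
      then show "(\<lambda>n. indicator {a<..<b} t *\<^sub>R (arc_powr (r n) w t * exp (\<i> * q * of_real t)))
        \<longlonglongrightarrow> indicator {a<..<b} t *\<^sub>R (arc_powr 1 w t * exp (\<i> * q * of_real t))"
        by (intro tendsto_intros)
    qed
    show "AE t in lborel. norm (indicator {a<..<b} t *\<^sub>R (arc_powr (r n) w t * exp (\<i> * q * of_real t)))
        \<le> E * arc_bound w t" for n
    proof (rule AE_I2)
      fix t :: real
      have "0 \<le> arc_bound w t"
        using norm_arc_powr_le[of 1 w t] by (auto intro: order_trans[OF norm_ge_zero])
      moreover have "norm (arc_powr (r n) w t * exp (\<i> * q * of_real t)) \<le> arc_bound w t * E" if "t \<in> {a<..<b}"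
        unfolding norm_mult using E[of t 0] that ab r[of n] \<open>0 \<le> arc_bound w t\<close>
        by (intro mult_mono norm_arc_powr_le) auto
      ultimately show "norm (indicator {a<..<b} t *\<^sub>R (arc_powr (r n) w t * exp (\<i> * q * of_real t)))
        \<le> E * arc_bound w t"
        by (auto simp: indicator_def mult.commute E_def)
    qed
  qed (use r in \<open>simp_all add: less_imp_le\<close>)
  moreover have "(\<lambda>n. ?I (r n)) \<longlonglongrightarrow> suminf ?c"
  proof -
    have bound: "norm (of_real (r n ^ k) * ?c k) \<le> 2 * E * norm ((w gchoose k) / (of_nat k + q))" for k n
    proof -
      have "norm (exp (\<i> * (of_nat k + q) * of_real b) - exp (\<i> * (of_nat k + q) * of_real a)) \<le> E + E"
        using ab by (intro order_trans[OF norm_triangle_ineq4] add_mono E) auto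
      moreover have "r n ^ k \<le> 1"
        using r[of n] by (intro power_le_one) auto
      ultimately have "r n ^ k * (norm ((w gchoose k) / (of_nat k + q)) *
           norm (exp (\<i> * (of_nat k + q) * of_real b) - exp (\<i> * (of_nat k + q) * of_real a)))
           \<le> 1 * (norm ((w gchoose k) / (of_nat k + q)) * (E + E))"
        using r[of n] by (intro mult_mono) auto
      then show ?thesis
        using r[of n] by (simp add: norm_mult norm_divide norm_power mult_ac)
    qed
    have "(\<lambda>n. \<Sum>k. of_real (r n ^ k) * ?c k) \<longlonglongrightarrow> suminf ?c"
    proof (rule tannerys_theorem[THEN conjunct2, THEN conjunct2])
      show "(\<lambda>n. of_real (r n ^ k) * ?c k) \<longlonglongrightarrow> ?c k" for k
        using tendsto_mult[OF tendsto_of_real[OF tendsto_power[OF r_lim, of k]] tendsto_const, of "?c k"]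
        by (simp only: power_one of_real_1 mult_1_left)
      show "\<forall>\<^sub>F (k, n) in at_top \<times>\<^sub>F sequentially. norm (of_real (r n ^ k) * ?c k)
              \<le> 2 * E * norm ((w gchoose k) / (of_nat k + q))"
        using bound by (intro always_eventually) auto
      show "summable (\<lambda>k. 2 * E * norm ((w gchoose k) / (of_nat k + q)))"
        using w by (intro summable_mult summable_norm_gbinomial_divide)
    qed auto
    then show ?thesis
      using integral_arc_powr_scaled[OF w q r ab] by simp
  qed
  ultimately show ?thesis
    by (rule LIMSEQ_unique)
qed

section \<open>Fourier representation of the binomial coefficient\<close>

text \<open>With q = -x, the values at both ends combine to 2 sin(pi q) (-1)^k, so the termwise
  integral is a multiple of the alternating series for B(w+1, q). The reflection formula then
  cancels Gamma(q). The exceptional integers form a null set, which suffices under the integral over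
  x.\<close>

lemma cbinom_eq_integral_arc_powr:
  fixes w :: complex and x :: real
  assumes w: "Re w > -1" and x: "x \<notin> \<int>"
  shows "(LINT t|lborel. arc_powr 1 w t * exp (- (\<i> * of_real x * of_real t))) =
           2 * of_real pi * cbinom w (of_real x)"
proof -
  define q where "q = - complex_of_real x"
  have q: "q \<notin> \<int>\<^sub>\<le>\<^sub>0"
    using x by (auto simp: q_def elim!: nonpos_Ints_cases)
      (metis Ints_of_int minus_equation_iff of_int_minus of_real_eq_iff of_real_of_int_eq)
  have exp_eq: "(exp (\<i> * (of_nat k + q) * of_real pi) - exp (\<i> * (of_nat k + q) * of_real (- pi))) / \<i> =
          2 * sin (of_real pi * q) * (- 1) ^ k" for k
  proof -
    have "\<i> * (of_nat k + q) * of_real pi = \<i> * q * of_real pi + of_nat k * (\<i> * of_real pi)"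
      by (simp add: algebra_simps)
    then have "exp (\<i> * (of_nat k + q) * of_real pi) = exp (\<i> * q * of_real pi) * exp (\<i> * of_real pi) ^ k"
      by (simp only: exp_add exp_of_nat_mult)
    moreover have "\<i> * (of_nat k + q) * of_real (- pi) = - (\<i> * q * of_real pi) + of_nat k * (- (\<i> * of_real pi))"
      by (simp add: algebra_simps)
    then have "exp (\<i> * (of_nat k + q) * of_real (- pi)) = exp (- (\<i> * q * of_real pi)) * exp (- (\<i> * of_real pi)) ^ k"
      by (simp only: exp_add exp_of_nat_mult)
    moreover have "exp (- (\<i> * of_real pi)) = - 1"
      by (simp add: exp_minus)
    ultimately show ?thesis
      by (simp add: sin_exp_eq mult_ac divide_simps) (simp add: algebra_simps)
  qed
  have "(LINT t|lborel. arc_powr 1 w t * exp (- (\<i> * of_real x * of_real t))) =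
          (LINT t|lborel. indicator {- pi<..<pi} t *\<^sub>R (arc_powr 1 w t * exp (\<i> * q * of_real t)))"
    by (intro Bochner_Integration.integral_cong) (auto simp: arc_powr_def q_def indicator_def)
  also have "\<dots> = (\<Sum>k. 2 * sin (of_real pi * q) * ((- 1) ^ k * ((w gchoose k) / (of_nat k + q))))"
    by (subst integral_arc_powr[OF w q]) (simp_all only: exp_eq, auto simp: mult_ac)
  also have "\<dots> = 2 * sin (of_real pi * q) * (\<Sum>k. (- 1) ^ k * ((w gchoose k) / (of_nat k + q)))"
  proof (rule suminf_mult)
    show "summable (\<lambda>k. (- 1) ^ k * ((w gchoose k) / (of_nat k + q)))"
      using summable_norm_gbinomial_divide[OF w, of q]
      by (intro summable_norm_cancel[where f = "\<lambda>k. (- 1) ^ k * ((w gchoose k) / (of_nat k + q))"])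
        (simp add: norm_mult norm_power norm_divide)
  qed
  \<comment> \<open>Writing the beta function with \<open>rGamma\<close> keeps the formula correct
    when w + 1 + q is a pole of Gamma.\<close>
  also have "\<dots> = 2 * sin (of_real pi * q) * (Gamma (w + 1) * Gamma q * rGamma (w + 1 + q))"
    unfolding suminf_gbinomial_eq_Beta[OF w q] Beta_altdef ..
  also have "sin (of_real pi * q) = of_real pi * (rGamma q * rGamma (1 - q))"
    by (simp add: rGamma_reflection_complex)
  also have "2 * (of_real pi * (rGamma q * rGamma (1 - q))) * (Gamma (w + 1) * Gamma q * rGamma (w + 1 + q)) =
      2 * of_real pi * (Gamma (w + 1) * rGamma (1 - q) * rGamma (w + 1 + q)) * (rGamma q * Gamma q)"
    by (simp only: mult_ac)
  also have "rGamma q * Gamma q = 1"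
    using q by (simp add: rGamma_inverse_Gamma Gamma_eq_zero_iff)
  also have "2 * of_real pi * (Gamma (w + 1) * rGamma (1 - q) * rGamma (w + 1 + q)) * 1 = 2 * of_real pi * cbinom w (of_real x)"
    by (simp add: cbinom_def q_def algebra_simps)
  finally show ?thesis .
qed

section \<open>The Fourier transform of a difference of simple poles\<close>

lemma path_image_real_linepath_subset:
  "path_image (linepath (- complex_of_real R) (of_real R)) \<subseteq> {z. Im z = 0}"
  by (auto simp: in_segment)

lemma path_image_upper_arc_subset:
  assumes "R > 0"
  shows "path_image (part_circlepath 0 R 0 pi) \<subseteq> {z. norm z = R \<and> Im z \<ge> 0}"
  using assms by (auto simp: path_image_part_circlepath' closed_segment_eq_real_ivl norm_mult sin_ge_zero)

lemma path_image_lower_arc_subset: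
  assumes "R > 0"
  shows "path_image (part_circlepath 0 R pi (2 * pi)) \<subseteq> {z. norm z = R \<and> Im z \<le> 0}"
proof -
  have "sin x \<le> 0" if "pi \<le> x" "x \<le> 2 * pi" for x
    using sin_ge_zero[of "x - pi"] that by (simp add: sin_diff)
  then show ?thesis
    using assms
    by (auto simp: path_image_part_circlepath' closed_segment_eq_real_ivl norm_mult
          intro!: mult_nonneg_nonpos)
qed

text \<open>Cauchy's theorem in a convex half-plane slightly larger than the closed upper one. The
  arc runs from R back to -R, hence the sign.\<close>

lemma contour_integral_real_line_eq_upper_arc:
  assumes f: "f holomorphic_on {z. Im z > - m}" and "m > 0" "R > 0"
  shows "contour_integral (linepath (- of_real R) (of_real R)) f = - contour_integral (part_circlepath 0 R 0 pi) f"
proof -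
  let ?L = "linepath (- complex_of_real R) (of_real R)" and ?C = "part_circlepath 0 R 0 pi"
  have sub: "path_image ?L \<subseteq> {z. Im z > - m}" "path_image ?C \<subseteq> {z. Im z > - m}"
    using path_image_real_linepath_subset[of R] path_image_upper_arc_subset[of R] assms by force+
  have cont: "continuous_on {z. Im z > - m} f"
    using f by (rule holomorphic_on_imp_continuous_on)
  have "(f has_contour_integral 0) (?L +++ ?C)"
    using sub by (intro Cauchy_theorem_convex_simple[OF f] valid_path_join)
      (auto simp: convex_halfspace_Im_gt path_image_join)
  moreover have "f contour_integrable_on ?L" "f contour_integrable_on ?C"
    using sub continuous_on_subset[OF cont]
    by (auto intro!: contour_integrable_continuous_linepath contour_integrable_continuous_part_circlepath)
  ultimately show ?thesis
    using contour_integral_unique[of f 0 "?L +++ ?C"] by (simp add: add_eq_0_iff2)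
qed

text \<open>The lower arc, like the segment, runs from -R to R, so no sign appears here.\<close>

lemma contour_integral_real_line_eq_lower_arc:
  assumes f: "f holomorphic_on UNIV" and "R > 0"
  shows "contour_integral (linepath (- of_real R) (of_real R)) f = contour_integral (part_circlepath 0 R pi (2 * pi)) f"
proof -
  let ?L = "linepath (- complex_of_real R) (of_real R)" and ?C = "part_circlepath 0 R pi (2 * pi)"
  have ends: "pathstart ?C = - of_real R" "pathfinish ?C = of_real R"
    using exp_two_pi_i by (simp_all add: mult_ac)
  have cont: "continuous_on UNIV f"
    using f by (rule holomorphic_on_imp_continuous_on)
  have "(f has_contour_integral 0) (?C +++ reversepath ?L)"
    using ends by (intro Cauchy_theorem_convex_simple[OF f] valid_path_join) auto
  moreover have "f contour_integrable_on reversepath ?L" "f contour_integrable_on ?C"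
    using continuous_on_subset[OF cont]
    by (auto intro!: contour_integrable_continuous_linepath contour_integrable_continuous_part_circlepath)
  ultimately have "contour_integral ?C f + contour_integral (reversepath ?L) f = 0"
    using contour_integral_unique[of f 0 "?C +++ reversepath ?L"]
    by (subst contour_integral_join [symmetric]) auto
  then show ?thesis
    by (subst (asm) contour_integral_reversepath) auto
qed

lemma contour_integral_circlepath_split:
  assumes "continuous_on {z. norm z = R} f" "R > 0"
  shows "contour_integral (circlepath 0 R) f =
           contour_integral (part_circlepath 0 R 0 pi) f + contour_integral (part_circlepath 0 R pi (2 * pi)) f"
proof -
  have "(\<lambda>t. f (0 + of_real R * cis t) * of_real R * \<i> * cis t) integrable_on {0..2 * pi}"
    using assms
    by (intro integrable_continuous_real continuous_intros continuous_on_compose2[OF assms(1)])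
      (auto simp: norm_mult)
  from Henstock_Kurzweil_Integration.integral_combine[OF _ _ this, of pi] show ?thesis
    unfolding circlepath_def by (simp add: contour_integral_part_circlepath_eq)
qed

text \<open>
  The integrand is split into an entire part, whose segment is deformed to the lower arc, and a
  multiple of \<open>1/(z + \<alpha>)\<close>, whose segment is deformed to the upper arc. Recombining on the lower arc
  leaves a full circle, so that no winding number of a half-disc is needed.
\<close>

lemma contour_integral_exp_pole_lower_arc:
  fixes \<alpha> :: complex and t R :: real
  assumes \<alpha>: "Im \<alpha> > 0" and R: "R > norm \<alpha>"
  shows "contour_integral (linepath (- of_real R) (of_real R)) (\<lambda>z. exp (- (\<i> * of_real t * z)) / (z + \<alpha>)) =
           contour_integral (part_circlepath 0 R pi (2 * pi)) (\<lambda>z. exp (- (\<i> * of_real t * z)) / (z + \<alpha>))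
             - 2 * of_real pi * \<i> * exp (\<i> * \<alpha> * of_real t)"
proof -
  define e where "e = (\<lambda>z. exp (- (\<i> * of_real t * z)))"
  define c where "c = e (- \<alpha>)"
  \<comment> \<open>The difference quotient of \<open>e\<close> at \<open>- \<alpha>\<close>, with
    the removable singularity filled by the derivative, which makes it entire.\<close>
  define G where "G = (\<lambda>z. if z = - \<alpha> then deriv e (- \<alpha>) else (e z - e (- \<alpha>)) / (z - - \<alpha>))"
  define s where "s = (\<lambda>z. c / (z + \<alpha>))"
  let ?L = "linepath (- complex_of_real R) (of_real R)" and ?U = "part_circlepath 0 R 0 pi"
    and ?D = "part_circlepath 0 R pi (2 * pi)"
  have R0: "R > 0" using R norm_ge_zero[of \<alpha>] by linarith
  have G: "G holomorphic_on UNIV"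
    unfolding G_def by (intro pole_lemma) (auto simp: e_def intro!: holomorphic_intros)
  have contG: "continuous_on A G" for A
    using G holomorphic_on_imp_continuous_on continuous_on_subset by blast
  have conts: "continuous_on A s" if "- \<alpha> \<notin> A" for A
    unfolding s_def using that by (intro continuous_intros) (metis add_eq_0_iff2)
  have split: "e z / (z + \<alpha>) = G z + s z" if "z \<noteq> - \<alpha>" for z
    using that by (simp add: G_def s_def c_def diff_divide_distrib)
  have nL: "- \<alpha> \<notin> path_image ?L"
    using path_image_real_linepath_subset[of R] \<alpha> by auto
  have nD: "- \<alpha> \<notin> path_image ?D"
    using path_image_lower_arc_subset[OF R0] R by auto
  have "contour_integral ?L (\<lambda>z. e z / (z + \<alpha>)) = contour_integral ?L (\<lambda>z. G z + s z)"
    using nL by (intro contour_integral_eq split) auto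
  also have "\<dots> = contour_integral ?L G + contour_integral ?L s"
    using nL by (intro contour_integral_add contour_integrable_continuous_linepath contG conts) auto
  also have "contour_integral ?L G = contour_integral ?D G"
    by (rule contour_integral_real_line_eq_lower_arc[OF G R0])
  also have "contour_integral ?L s = - contour_integral ?U s"
    using \<alpha> R0 unfolding s_def
    by (intro contour_integral_real_line_eq_upper_arc[where m = "Im \<alpha>"] holomorphic_intros)
      (auto simp: complex_eq_iff)
  also have "contour_integral ?D G + - contour_integral ?U s =
      (contour_integral ?D G + contour_integral ?D s) - (contour_integral ?U s + contour_integral ?D s)"
    by simp
  also have "contour_integral ?D G + contour_integral ?D s = contour_integral ?D (\<lambda>z. G z + s z)"
    using nD by (intro contour_integral_add [symmetric] contour_integrable_continuous_part_circlepath contG conts) auto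
  also have "\<dots> = contour_integral ?D (\<lambda>z. e z / (z + \<alpha>))"
    using nD by (intro contour_integral_eq split [symmetric]) auto
  also have "contour_integral ?U s + contour_integral ?D s = contour_integral (circlepath 0 R) s"
    using R R0 by (intro contour_integral_circlepath_split [symmetric] conts) auto
  also have "contour_integral (circlepath 0 R) s = 2 * of_real pi * \<i> * c"
    using Cauchy_integral_circlepath_simple[of "\<lambda>_. c" 0 R "- \<alpha>"] R
    unfolding s_def by (intro contour_integral_unique) auto
  also have "c = exp (\<i> * \<alpha> * of_real t)"
    by (simp add: c_def e_def mult_ac)
  finally show ?thesis
    by (simp add: e_def)
qed

lemma norm_real_add_ge:
  fixes \<alpha> :: complex
  assumes "Im \<alpha> > 0"
  obtains c where "c > 0" "\<And>x::real. c * (1 + \<bar>x\<bar>) \<le> norm (of_real x + \<alpha>)"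
proof -
  \<comment> \<open>The summand 1 pays for |x| <= |x + \<alpha>| + |\<alpha>|; the quotient pays for
    the remaining constant 1 + |\<alpha>|, because |x + \<alpha>| >= Im \<alpha>.\<close>
  define M where "M = 1 + (1 + norm \<alpha>) / Im \<alpha>"
  have M: "M > 0"
    using assms by (simp add: M_def add_pos_nonneg)
  have "inverse M * (1 + \<bar>x\<bar>) \<le> norm (of_real x + \<alpha>)" for x :: real
  proof -
    have "\<bar>x\<bar> \<le> norm (of_real x + \<alpha>) + norm \<alpha>"
      using norm_triangle_ineq4[of "of_real x + \<alpha>" \<alpha>] by simp
    moreover have "Im \<alpha> \<le> norm (of_real x + \<alpha>)"
      using abs_Im_le_cmod[of "of_real x + \<alpha>"] by simp
    then have "(1 + norm \<alpha>) / Im \<alpha> * Im \<alpha> \<le> (1 + norm \<alpha>) / Im \<alpha> * norm (of_real x + \<alpha>)"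
      using assms by (intro mult_left_mono) auto
    then have "1 + norm \<alpha> \<le> (1 + norm \<alpha>) / Im \<alpha> * norm (of_real x + \<alpha>)"
      using assms by simp
    ultimately have "1 + \<bar>x\<bar> \<le> M * norm (of_real x + \<alpha>)"
      by (simp add: M_def distrib_right)
    then show ?thesis
      using M by (simp add: field_simps)
  qed
  then show ?thesis
    using M that[of "inverse M"] by simp
qed

text \<open>Each half-line is an affine image of [1, infinity), where x^(-p) is integrable.\<close>

lemma integrable_one_plus_abs_powr:
  fixes p :: real
  assumes "p > 1"
  shows "integrable lborel (\<lambda>x::real. (1 + \<bar>x\<bar>) powr (- p))"
proof -
  have "set_integrable lebesgue {1..} (\<lambda>x::real. x powr (- p))"
    using has_integral_powr_to_inf[of "- p" 1] assms
    by (intro nonnegative_absolutely_integrable_1) auto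
  then have "integrable lborel (\<lambda>x::real. indicator {1..} x * x powr (- p))"
    unfolding set_integrable_def by (simp add: integrable_completion)
  note aff = lborel_integrable_real_affine[OF this]
  have "integrable lborel (\<lambda>x::real. indicator {1..} (1 + 1 * x) * (1 + 1 * x) powr (- p)
      + indicator {1..} (1 + - 1 * x) * (1 + - 1 * x) powr (- p))"
    by (rule Bochner_Integration.integrable_add[OF aff[of 1 1] aff[of "- 1" 1]]) auto
  then show ?thesis
  proof (rule Bochner_Integration.integrable_bound)
    have "norm ((1 + \<bar>x\<bar>) powr (- p)) \<le> norm (indicator {1..} (1 + 1 * x) * (1 + 1 * x) powr (- p)
      + indicator {1..} (1 + - 1 * x) * (1 + - 1 * x) powr (- p))" for x :: real
      by (auto simp: indicator_def)
    then show "AE x in lborel. norm ((1 + \<bar>x\<bar>) powr (- p)) \<le> norm (indicator {1..} (1 + 1 * x) * (1 + 1 * x) powr (- p)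
      + indicator {1..} (1 + - 1 * x) * (1 + - 1 * x) powr (- p))"
      by simp
  qed measurable
qed

lemma pole_difference_eq:
  fixes \<alpha> \<beta> z :: complex
  assumes "z + \<alpha> \<noteq> 0" "z + \<beta> \<noteq> 0"
  shows "1 / (z + \<alpha>) - 1 / (z + \<beta>) = (\<beta> - \<alpha>) / ((z + \<alpha>) * (z + \<beta>))"
  using assms by (simp add: divide_simps)

text \<open>Subtracting the second pole improves the decay from order 1/|x| to order 1/x^2.\<close>

lemma integrable_pole_difference:
  fixes \<alpha> \<beta> :: complex
  assumes \<alpha>: "Im \<alpha> > 0" and \<beta>: "Im \<beta> > 0"
  shows "integrable lborel (\<lambda>x. 1 / (of_real x + \<alpha>) - 1 / (of_real x + \<beta>))"
proof -
  obtain c where c: "c > 0" "\<And>x::real. c * (1 + \<bar>x\<bar>) \<le> norm (of_real x + \<alpha>)"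
    using norm_real_add_ge[OF \<alpha>] by metis
  obtain d where d: "d > 0" "\<And>x::real. d * (1 + \<bar>x\<bar>) \<le> norm (of_real x + \<beta>)"
    using norm_real_add_ge[OF \<beta>] by metis
  have "integrable lborel (\<lambda>x::real. norm (\<beta> - \<alpha>) / (c * d) * (1 + \<bar>x\<bar>) powr (- 2))"
    by (intro integrable_mult_right integrable_one_plus_abs_powr) auto
  then show ?thesis
  proof (rule Bochner_Integration.integrable_bound)
    have "norm (1 / (of_real x + \<alpha>) - 1 / (of_real x + \<beta>))
            \<le> norm (norm (\<beta> - \<alpha>) / (c * d) * (1 + \<bar>x\<bar>) powr (- 2))" for x :: real
    proof -
      have nz: "of_real x + \<alpha> \<noteq> 0" "of_real x + \<beta> \<noteq> 0"
        using assms by (auto simp: complex_eq_iff)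
      then have "norm (1 / (of_real x + \<alpha>) - 1 / (of_real x + \<beta>)) =
              norm (\<beta> - \<alpha>) / (norm (of_real x + \<alpha>) * norm (of_real x + \<beta>))"
        by (simp add: pole_difference_eq norm_divide norm_mult)
      also have "\<dots> \<le> norm (\<beta> - \<alpha>) / ((c * (1 + \<bar>x\<bar>)) * (d * (1 + \<bar>x\<bar>)))"
        using c d nz by (intro divide_left_mono mult_mono mult_pos_pos) auto
      also have "\<dots> = norm (\<beta> - \<alpha>) / (c * d) * (1 + \<bar>x\<bar>) powr (- 2)"
        by (simp add: powr_minus powr_numeral power2_eq_square divide_simps)
      finally show ?thesis
        using c d by simp
    qed
    then show "AE x in lborel. norm (1 / (of_real x + \<alpha>) - 1 / (of_real x + \<beta>))
            \<le> norm (norm (\<beta> - \<alpha>) / (c * d) * (1 + \<bar>x\<bar>) powr (- 2))"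
      by simp
  qed measurable
qed

text \<open>Both poles lie in the lower half-plane. For t > 0 the exponential is bounded there, and
  closing the contour below collects both residues; for t < 0 it is closed above and nothing is
  collected. On arcs of length pi R the integrand is of order 1/R^2, so the arcs vanish in the
  limit.\<close>

lemma fourier_pole_difference:
  fixes \<alpha> \<beta> :: complex and t :: real
  assumes \<alpha>: "Im \<alpha> > 0" and \<beta>: "Im \<beta> > 0" and t: "t \<noteq> 0"
  shows "(LINT x|lborel. (1 / (of_real x + \<alpha>) - 1 / (of_real x + \<beta>)) * exp (- (\<i> * of_real t * of_real x))) =
           (if t > 0 then - 2 * of_real pi * \<i> * (exp (\<i> * \<alpha> * of_real t) - exp (\<i> * \<beta> * of_real t)) else 0)"
    (is "?I = ?rhs")
proof -
  define f where "f = (\<lambda>\<gamma> z. exp (- (\<i> * of_real t * z)) / (z + \<gamma>))"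
  define h where "h = (\<lambda>z. f \<alpha> z - f \<beta> z)"
  have h_real: "h (of_real x) = (1 / (of_real x + \<alpha>) - 1 / (of_real x + \<beta>)) * exp (- (\<i> * of_real t * of_real x))" for x
    by (simp add: h_def f_def diff_divide_distrib algebra_simps)
  have meas: "(\<lambda>x. h (of_real x)) \<in> borel_measurable lborel"
    unfolding h_real by measurable
  have h_int: "integrable lborel (\<lambda>x. h (of_real x))"
    by (rule Bochner_Integration.integrable_bound[OF integrable_pole_difference[OF \<alpha> \<beta>] meas])
      (auto simp: h_real norm_mult)
  let ?L = "\<lambda>R. linepath (- complex_of_real R) (of_real R)" and ?U = "\<lambda>R. part_circlepath 0 R 0 pi"
    and ?D = "\<lambda>R. part_circlepath 0 R pi (2 * pi)"
  \<comment> \<open>The half-plane is chosen such that t Im z <= 0, so the exponential has modulus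
    at most 1 on the arc.\<close>
  define arc where "arc = (\<lambda>R. if t > 0 then ?D R else ?U R)"
  have contf: "continuous_on A (f \<gamma>)" if "- \<gamma> \<notin> A" for A \<gamma>
    unfolding f_def using that by (intro continuous_intros) (metis add_eq_0_iff2)
  have "(\<lambda>n. LINT x|lborel. indicator {- real n..real n} x *\<^sub>R h (of_real x)) \<longlonglongrightarrow> (LINT x|lborel. h (of_real x))"
  proof (rule integral_dominated_convergence[OF meas _ integrable_norm[OF h_int]])
    show "AE x in lborel. (\<lambda>n. indicator {- real n..real n} x *\<^sub>R h (of_real x)) \<longlonglongrightarrow> h (of_real x)"
    proof (rule AE_I2, rule tendsto_eventually)
      fix x :: real
      show "\<forall>\<^sub>F n in sequentially. indicator {- real n..real n} x *\<^sub>R h (of_real x) = h (of_real x)"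
        using eventually_ge_at_top[of "nat \<lceil>\<bar>x\<bar>\<rceil>"]
      proof eventually_elim
        case (elim n)
        then have "\<bar>x\<bar> \<le> real n" by linarith
        then show ?case by (auto simp: indicator_def)
      qed
    qed
  qed (use meas in \<open>auto simp: indicator_def\<close>)
  moreover have "(\<lambda>n. LINT x|lborel. indicator {- real n..real n} x *\<^sub>R h (of_real x)) \<longlonglongrightarrow> 0 + ?rhs"
  proof -
    define N where "N = nat \<lceil>norm \<alpha> + norm \<beta> + 1\<rceil>"
    have arc_sub: "path_image (arc R) \<subseteq> {z. norm z = R \<and> t * Im z \<le> 0}" if "R > 0" for R
      using path_image_upper_arc_subset[OF that] path_image_lower_arc_subset[OF that]
      by (auto simp: arc_def mult_nonneg_nonpos mult_nonpos_nonneg)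
    \<comment> \<open>The sign reflects the orientation of the arc, and \<open>?rhs\<close> is
      exactly the residue contribution, already independent of \<open>R\<close>.\<close>
    have contour: "(LINT x|lborel. indicator {- R..R} x *\<^sub>R h (of_real x)) =
        (if t > 0 then 1 else - 1) * contour_integral (arc R) h + ?rhs" if R: "R > norm \<alpha>" "R > norm \<beta>" for R
    proof -
      have R0: "R > 0" using R norm_ge_zero[of \<alpha>] by linarith
      have "(LINT x|lborel. indicator {- R..R} x *\<^sub>R h (of_real x)) = integral {- R..R} (\<lambda>x. h (of_real x))"
        using set_borel_integral_eq_integral(2)[of "{- R..R}" "\<lambda>x. h (of_real x)"] h_int
        by (simp add: set_lebesgue_integral_def set_integrable_def integrable_mult_indicator)
      also have "\<dots> = contour_integral (?L R) h"
        using R0 by (subst contour_integral_linepath_Reals_eq) auto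
      also have "\<dots> = contour_integral (?L R) (f \<alpha>) - contour_integral (?L R) (f \<beta>)"
        unfolding h_def using path_image_real_linepath_subset[of R] \<alpha> \<beta>
        by (intro contour_integral_diff contour_integrable_continuous_linepath contf) auto
      also have "\<dots> = (if t > 0 then 1 else - 1) * (contour_integral (arc R) (f \<alpha>) - contour_integral (arc R) (f \<beta>)) + ?rhs"
      proof (cases "t > 0")
        case True
        then show ?thesis
          unfolding f_def contour_integral_exp_pole_lower_arc[OF \<alpha> R(1)] contour_integral_exp_pole_lower_arc[OF \<beta> R(2)]
          by (simp add: arc_def algebra_simps)
      next
        case False
        have "contour_integral (?L R) (f \<gamma>) = - contour_integral (?U R) (f \<gamma>)" if "Im \<gamma> > 0" for \<gamma>
          using that R0 unfolding f_def
          by (intro contour_integral_real_line_eq_upper_arc[where m = "Im \<gamma>"] holomorphic_intros)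
            (auto simp: complex_eq_iff)
        with False \<alpha> \<beta> show ?thesis
          by (simp add: arc_def)
      qed
      also have "contour_integral (arc R) (f \<alpha>) - contour_integral (arc R) (f \<beta>) = contour_integral (arc R) h"
      proof -
        have "- \<alpha> \<notin> path_image (arc R)" "- \<beta> \<notin> path_image (arc R)"
          using arc_sub[OF R0] R by auto
        then have "f \<alpha> contour_integrable_on arc R" "f \<beta> contour_integrable_on arc R"
          using contf by (auto simp: arc_def intro!: contour_integrable_continuous_part_circlepath)
        then show ?thesis
          unfolding h_def by (rule contour_integral_diff [symmetric])
      qed
      finally show ?thesis .
    qed
    have bound: "norm (contour_integral (arc R) h) \<le> norm (\<beta> - \<alpha>) / ((R - norm \<alpha>) * (R - norm \<beta>)) * R * pi"
      if R: "R > norm \<alpha>" "R > norm \<beta>" for R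
    proof -
      have R0: "R > 0" using R norm_ge_zero[of \<alpha>] by linarith
      have ptw: "norm (h z) \<le> norm (\<beta> - \<alpha>) / ((R - norm \<alpha>) * (R - norm \<beta>))" if "z \<in> path_image (arc R)" for z
      proof -
        have z: "norm z = R" "t * Im z \<le> 0"
          using arc_sub[OF R0] that by auto
        have ge: "R - norm \<alpha> \<le> norm (z + \<alpha>)" "R - norm \<beta> \<le> norm (z + \<beta>)"
          using norm_diff_ineq[of z] z by auto
        then have nz: "z + \<alpha> \<noteq> 0" "z + \<beta> \<noteq> 0"
          using R by auto
        have "h z = (1 / (z + \<alpha>) - 1 / (z + \<beta>)) * exp (- (\<i> * of_real t * z))"
          by (simp add: h_def f_def algebra_simps)
        then have "norm (h z) = norm (\<beta> - \<alpha>) / (norm (z + \<alpha>) * norm (z + \<beta>)) * exp (t * Im z)"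
          using nz by (simp add: pole_difference_eq norm_mult norm_divide)
        also have "\<dots> \<le> norm (\<beta> - \<alpha>) / (norm (z + \<alpha>) * norm (z + \<beta>))"
          using z by (intro mult_left_le) auto
        also have "\<dots> \<le> norm (\<beta> - \<alpha>) / ((R - norm \<alpha>) * (R - norm \<beta>))"
          using ge R nz by (intro divide_left_mono mult_mono mult_pos_pos) auto
        finally show ?thesis .
      qed
      have "- \<alpha> \<notin> path_image (arc R)" "- \<beta> \<notin> path_image (arc R)"
        using arc_sub[OF R0] R by auto
      then have "h contour_integrable_on arc R"
        unfolding h_def using contf
        by (intro contour_integrable_diff) (auto simp: arc_def intro!: contour_integrable_continuous_part_circlepath)
      moreover have "0 \<le> norm (\<beta> - \<alpha>) / ((R - norm \<alpha>) * (R - norm \<beta>))"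
        using R by simp
      ultimately show ?thesis
        using contour_integral_bound_part_circlepath[of h 0 R 0 pi "norm (\<beta> - \<alpha>) / ((R - norm \<alpha>) * (R - norm \<beta>))"]
          contour_integral_bound_part_circlepath[of h 0 R pi "2 * pi" "norm (\<beta> - \<alpha>) / ((R - norm \<alpha>) * (R - norm \<beta>))"] ptw R0
        by (cases "t > 0") (simp_all add: arc_def)
    qed
    have large: "real n > norm \<alpha>" "real n > norm \<beta>" if "n \<ge> N" for n
      using that norm_ge_zero[of \<alpha>] norm_ge_zero[of \<beta>] unfolding N_def by linarith+
    have "(\<lambda>n. (if t > 0 then 1 else - 1) * contour_integral (arc (real n)) h) \<longlonglongrightarrow> 0"
    proof (rule Lim_null_comparison)
      show "\<forall>\<^sub>F n in sequentially. norm ((if t > 0 then 1 else - 1) * contour_integral (arc (real n)) h) \<le>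
          norm (\<beta> - \<alpha>) / ((real n - norm \<alpha>) * (real n - norm \<beta>)) * real n * pi"
        using eventually_ge_at_top[of N] by eventually_elim (use bound large in \<open>auto simp: norm_mult\<close>)
      show "(\<lambda>n. norm (\<beta> - \<alpha>) / ((real n - norm \<alpha>) * (real n - norm \<beta>)) * real n * pi) \<longlonglongrightarrow> 0"
        by real_asymp
    qed
    then have "(\<lambda>n. (if t > 0 then 1 else - 1) * contour_integral (arc (real n)) h + ?rhs) \<longlonglongrightarrow> 0 + ?rhs"
      by (intro tendsto_add tendsto_const)
    moreover have "\<forall>\<^sub>F n in sequentially. (if t > 0 then 1 else - 1) * contour_integral (arc (real n)) h + ?rhs =
        (LINT x|lborel. indicator {- real n..real n} x *\<^sub>R h (of_real x))"
      using eventually_ge_at_top[of N] by eventually_elim (use contour large in auto)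
    ultimately show ?thesis
      by (rule Lim_transform_eventually)
  qed
  ultimately have "(LINT x|lborel. h (of_real x)) = 0 + ?rhs"
    by (rule LIMSEQ_unique)
  then show ?thesis
    by (simp add: h_real)
qed

section \<open>Decay of the binomial coefficient on the real line\<close>

lemma Im_pos_notin_nonpos_Ints:
  assumes "Im \<alpha> > 0"
  shows "\<alpha> \<notin> \<int>\<^sub>\<le>\<^sub>0"
  using assms by (auto elim!: nonpos_Ints_cases)

lemma cbinom_add_one: "(z + 1) * cbinom w (z + 1) = (w - z) * cbinom w z"
proof -
  have "(z + 1) * cbinom w (z + 1) = Gamma (w + 1) * ((z + 1) * rGamma (z + 1 + 1)) * rGamma (w - z)"
    by (simp add: cbinom_def)
  also have "\<dots> = Gamma (w + 1) * rGamma (z + 1) * ((w - z) * rGamma (w - z + 1))"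
    by (simp only: rGamma_plus1)
  also have "\<dots> = (w - z) * cbinom w z"
    by (simp add: cbinom_def mult_ac)
  finally show ?thesis .
qed

lemma cbinom_symmetric: "cbinom w (w - z) = cbinom w z"
  by (simp add: cbinom_def mult_ac)

lemma continuous_on_cbinom [continuous_intros]:
  assumes "continuous_on A f"
  shows "continuous_on A (\<lambda>x. cbinom w (f x))"
  unfolding cbinom_def
  by (intro continuous_intros continuous_on_compose2[OF continuous_on_rGamma[of UNIV]] assms) auto

lemma borel_measurable_cbinom [measurable]:
  "(\<lambda>x. cbinom w (of_real x)) \<in> borel_measurable borel"
  by (intro borel_measurable_continuous_onI continuous_intros)

text \<open>Iterating \<open>cbinom_add_one\<close> produces precisely the product estimated by
  \<open>norm_prod_one_minus_divide_le\<close>.\<close>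

lemma norm_cbinom_add_of_nat:
  assumes "Re \<zeta> > -1"
  shows "norm (cbinom w (\<zeta> + of_nat n)) =
           norm (cbinom w \<zeta>) * (\<Prod>j=1..n. norm (1 - (w + 1) / (\<zeta> + of_nat j)))"
proof (induction n)
  case (Suc n)
  have nz: "\<zeta> + of_nat (Suc n) \<noteq> 0"
    using assms by (auto simp: complex_eq_iff)
  have "(\<zeta> + of_nat (Suc n)) * cbinom w (\<zeta> + of_nat (Suc n)) = (w - (\<zeta> + of_nat n)) * cbinom w (\<zeta> + of_nat n)"
    using cbinom_add_one[of "\<zeta> + of_nat n" w] by (simp add: add_ac)
  then have "cbinom w (\<zeta> + of_nat (Suc n)) = (w - (\<zeta> + of_nat n)) / (\<zeta> + of_nat (Suc n)) * cbinom w (\<zeta> + of_nat n)"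
    using nz by (simp add: nonzero_eq_divide_eq mult_ac)
  also have "(w - (\<zeta> + of_nat n)) / (\<zeta> + of_nat (Suc n)) = - (1 - (w + 1) / (\<zeta> + of_nat (Suc n)))"
    using nz by (simp add: divide_simps del: of_nat_Suc) (simp add: algebra_simps)
  finally show ?case
    using Suc.IH by (simp only: norm_mult norm_minus_cancel) (simp del: of_nat_Suc)
qed auto

text \<open>The distance \<open>y\<close> is split into its integer part, handled by the product
  bound, and its fractional part, handled by compactness of [0,1].\<close>

lemma norm_cbinom_ray_le:
  assumes w: "Re w > -1" and \<zeta>: "Re \<zeta> > -1"
  obtains C where "\<And>y::real. y \<ge> 0 \<Longrightarrow> norm (cbinom w (\<zeta> + of_real y)) \<le> C * (1 + y) powr (- (Re w + 1))"
proof -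
  define \<delta> where "\<delta> = min 1 (Re \<zeta> + 1)"
  have \<delta>: "0 < \<delta>" "\<delta> \<le> 1" "\<delta> - 1 \<le> Re \<zeta>"
    using \<zeta> by (auto simp: \<delta>_def)
  have "bounded ((\<lambda>x::real. cbinom w (\<zeta> + of_real x)) ` {0..1})"
    by (intro compact_imp_bounded compact_continuous_image continuous_intros compact_Icc)
  then obtain M where M: "\<And>x::real. x \<in> {0..1} \<Longrightarrow> norm (cbinom w (\<zeta> + of_real x)) \<le> M"
    unfolding bounded_iff by blast
  have M0: "M \<ge> 0"
    using order_trans[OF norm_ge_zero M[of 0]] by simp
  \<comment> \<open>The added 1 absorbs the fractional part \<open>x\<close>, so that
    \<open>K\<close> works for every starting point \<zeta> + x.\<close>
  define K where "K = exp (norm (w + 1) ^ 2 / \<delta> ^ 2 + norm (w + 1) * (norm (1 - \<zeta>) + 1) / \<delta>)"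
  have "norm (cbinom w (\<zeta> + of_real y)) \<le> M * K * (1 / 2) powr (- (Re w + 1)) * (1 + y) powr (- (Re w + 1))"
    if y: "y \<ge> 0" for y
  proof -
    define n where "n = nat \<lfloor>y\<rfloor>"
    define x where "x = y - real n"
    have x: "0 \<le> x" "x \<le> 1"
      using y unfolding x_def n_def by linarith+
    have Re_x: "Re (\<zeta> + of_real x) > -1"
      using \<zeta> x by simp
    have "norm (cbinom w (\<zeta> + of_real y)) = norm (cbinom w (\<zeta> + of_real x + of_nat n))"
      by (simp add: x_def)
    also have "\<dots> = norm (cbinom w (\<zeta> + of_real x)) * (\<Prod>j=1..n. norm (1 - (w + 1) / (\<zeta> + of_real x + of_nat j)))"
      by (rule norm_cbinom_add_of_nat[OF Re_x])
    also have "\<dots> \<le> M * (exp (norm (w + 1) ^ 2 / \<delta> ^ 2 + norm (w + 1) * norm (1 - (\<zeta> + of_real x)) / \<delta>)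
        * ((real n + 2) / 2) powr (- Re (w + 1)))"
      using M[of x] x w \<delta> M0 by (intro mult_mono norm_prod_one_minus_divide_le prod_nonneg) auto
    also have "\<dots> \<le> M * (K * (((1 + y) / 2) powr (- (Re w + 1))))"
    proof (intro mult_left_mono mult_mono M0)
      have "norm (1 - (\<zeta> + of_real x)) \<le> norm (1 - \<zeta>) + norm (complex_of_real x)"
        using norm_triangle_ineq4[of "1 - \<zeta>" "of_real x"] by (simp add: algebra_simps)
      then have "norm (1 - (\<zeta> + of_real x)) \<le> norm (1 - \<zeta>) + 1"
        using x by simp
      then show "exp (norm (w + 1) ^ 2 / \<delta> ^ 2 + norm (w + 1) * norm (1 - (\<zeta> + of_real x)) / \<delta>) \<le> K"
        unfolding K_def using \<delta> by (auto intro!: divide_right_mono mult_left_mono)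
      show "((real n + 2) / 2) powr (- Re (w + 1)) \<le> ((1 + y) / 2) powr (- (Re w + 1))"
        using w x y by (simp del: minus_add_distrib) (rule powr_mono2', auto simp: x_def)
    qed (auto simp: K_def)
    also have "\<dots> = M * K * (1 / 2) powr (- (Re w + 1)) * (1 + y) powr (- (Re w + 1))"
      using y powr_mult[of "1 / 2" "1 + y" "- (Re w + 1)"] by (simp add: mult_ac)
    finally show ?thesis .
  qed
  then show ?thesis
    using that by blast
qed

text \<open>For x >= 0 the ray starts at 0. For x < 0 the symmetry replaces x by w - x = w + |x|, a
  point on the ray starting at \<open>w\<close>.\<close>

lemma norm_cbinom_real_le:
  assumes w: "Re w > -1"
  obtains C where "C \<ge> 0" "\<And>x::real. norm (cbinom w (of_real x)) \<le> C * (1 + \<bar>x\<bar>) powr (- (Re w + 1))"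
proof -
  obtain C1 where C1: "\<And>y::real. y \<ge> 0 \<Longrightarrow> norm (cbinom w (0 + of_real y)) \<le> C1 * (1 + y) powr (- (Re w + 1))"
    using norm_cbinom_ray_le[OF w, of 0] by auto
  obtain C2 where C2: "\<And>y::real. y \<ge> 0 \<Longrightarrow> norm (cbinom w (w + of_real y)) \<le> C2 * (1 + y) powr (- (Re w + 1))"
    using norm_cbinom_ray_le[OF w w] by auto
  have C: "norm (cbinom w (of_real x)) \<le> max C1 C2 * (1 + \<bar>x\<bar>) powr (- (Re w + 1))" for x :: real
  proof (cases "x \<ge> 0")
    case True
    then have "norm (cbinom w (of_real x)) \<le> C1 * (1 + \<bar>x\<bar>) powr (- (Re w + 1))"
      using C1[of x] by simp
    also have "\<dots> \<le> max C1 C2 * (1 + \<bar>x\<bar>) powr (- (Re w + 1))"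
      by (intro mult_right_mono) auto
    finally show ?thesis .
  next
    case False
    then have "norm (cbinom w (of_real x)) \<le> C2 * (1 + \<bar>x\<bar>) powr (- (Re w + 1))"
      using C2[of "- x"] cbinom_symmetric[of w "of_real x"] by simp
    also have "\<dots> \<le> max C1 C2 * (1 + \<bar>x\<bar>) powr (- (Re w + 1))"
      by (intro mult_right_mono) auto
    finally show ?thesis .
  qed
  have "max C1 C2 \<ge> 0"
    using order_trans[OF norm_ge_zero C[of 0]] by simp
  with C show ?thesis
    using that by blast
qed

lemma integrable_powr_bound:
  fixes h :: "real \<Rightarrow> complex"
  assumes "h \<in> borel_measurable borel" "p > 1"
    and "\<And>x. norm (h x) \<le> C * (1 + \<bar>x\<bar>) powr (- p)"
  shows "integrable lborel h"
proof (rule Bochner_Integration.integrable_bound)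
  show "integrable lborel (\<lambda>x::real. C * (1 + \<bar>x\<bar>) powr (- p))"
    using assms(2) by (intro integrable_mult_right integrable_one_plus_abs_powr)
  have "norm (h x) \<le> norm (C * (1 + \<bar>x\<bar>) powr (- p))" for x
    using assms(3)[of x] by (auto intro: order_trans)
  then show "AE x in lborel. norm (h x) \<le> norm (C * (1 + \<bar>x\<bar>) powr (- p))"
    by simp
qed (use assms(1) in simp)

lemma powr_minus_add_one:
  fixes y a :: real
  assumes "y > 0"
  shows "y powr (- (a + 1)) = y powr (- a) / y"
proof -
  have "- (a + 1) = - a - 1" by simp
  then show ?thesis
    using assms by (simp only: powr_diff) simp
qed

lemma integrable_cbinom_divide_upper_half_plane:
  assumes w: "Re w > -1" and \<alpha>: "Im \<alpha> > 0"
  shows "integrable lborel (\<lambda>x. cbinom w (of_real x) / (of_real x + \<alpha>))"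
proof -
  obtain c where c: "c > 0" "\<And>x::real. c * (1 + \<bar>x\<bar>) \<le> norm (of_real x + \<alpha>)"
    using norm_real_add_ge[OF \<alpha>] by metis
  obtain C where C: "C \<ge> 0" "\<And>x::real. norm (cbinom w (of_real x)) \<le> C * (1 + \<bar>x\<bar>) powr (- (Re w + 1))"
    using norm_cbinom_real_le[OF w] by blast
  show ?thesis
  proof (rule integrable_powr_bound)
    fix x :: real
    have "norm (cbinom w (of_real x) / (of_real x + \<alpha>)) \<le>
            (C * (1 + \<bar>x\<bar>) powr (- (Re w + 1))) / (c * (1 + \<bar>x\<bar>))"
      unfolding norm_divide using c C by (intro frac_le) (auto simp: add_pos_nonneg)
    also have "\<dots> = C / c * (1 + \<bar>x\<bar>) powr (- (Re w + 1 + 1))"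
      by (subst powr_minus_add_one) auto
    finally show "norm (cbinom w (of_real x) / (of_real x + \<alpha>)) \<le> C / c * (1 + \<bar>x\<bar>) powr (- (Re w + 1 + 1))" .
  qed (use w in auto)
qed

text \<open>The factor 1/Gamma(x + 1) vanishes at x = -(n+1) and cancels the pole. Near that point
  boundedness suffices; elsewhere the denominator has modulus at least 1 and is comparable to 1 +
  |x|.\<close>

lemma integrable_cbinom_divide_pos_int:
  assumes w: "Re w > -1"
  shows "integrable lborel (\<lambda>x. cbinom w (of_real x) / (of_real x + of_nat (Suc n)))"
proof -
  \<comment> \<open>Away from \<open>x = -(n + 1)\<close> the quotient is this continuous function.\<close>
  define H where "H = (\<lambda>x::real. Gamma (w + 1) * pochhammer (of_real x + 1) n *
      rGamma (of_real x + 1 + of_nat (Suc n)) * rGamma (w - of_real x + 1))"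
  have factor: "cbinom w (of_real x) = (of_real x + of_nat (Suc n)) * H x" for x
  proof -
    have "rGamma (of_real x + 1) = pochhammer (of_real x + 1) (Suc n) * rGamma (of_real x + 1 + of_nat (Suc n) :: complex)"
      by (rule pochhammer_rGamma)
    also have "pochhammer (complex_of_real x + 1) (Suc n) = (of_real x + of_nat (Suc n)) * pochhammer (of_real x + 1) n"
      by (simp add: pochhammer_rec' add_ac)
    finally show ?thesis
      by (simp add: cbinom_def H_def mult_ac)
  qed
  obtain C where C: "C \<ge> 0" "\<And>x::real. norm (cbinom w (of_real x)) \<le> C * (1 + \<bar>x\<bar>) powr (- (Re w + 1))"
    using norm_cbinom_real_le[OF w] by blast
  \<comment> \<open>The interval of radius 1 around the pole; on it 1 + |x| <= n + 3, which explains
    the constants in \<open>D\<close>.\<close>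
  let ?I = "{- real n - 2..- real n}"
  have "bounded (H ` ?I)"
    unfolding H_def pochhammer_prod
    by (intro compact_imp_bounded compact_continuous_image continuous_intros compact_Icc
        continuous_on_compose2[OF continuous_on_rGamma[of UNIV]]) auto
  then obtain M where M: "\<And>x. x \<in> ?I \<Longrightarrow> norm (H x) \<le> M"
    unfolding bounded_iff by blast
  define p where "p = Re w + 1 + 1"
  have p: "p > 1"
    using w by (simp add: p_def)
  define D where "D = max (M / (real n + 3) powr (- p)) (C * (real n + 3))"
  show ?thesis
  proof (rule integrable_powr_bound[OF _ p])
    fix x :: real
    show "norm (cbinom w (of_real x) / (of_real x + of_nat (Suc n))) \<le> D * (1 + \<bar>x\<bar>) powr (- p)"
    proof (cases "x \<in> ?I")
      case True
      \<comment> \<open>Only an inequality, since at the pole itself the quotient is 0 by the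
        convention on division by zero.\<close>
      have "norm (cbinom w (of_real x) / (of_real x + of_nat (Suc n))) \<le> norm (H x)"
        by (simp add: factor)
      also have "\<dots> \<le> M"
        using M True by blast
      also have "M = M / (real n + 3) powr (- p) * (real n + 3) powr (- p)"
        by simp
      also have "\<dots> \<le> D * (1 + \<bar>x\<bar>) powr (- p)"
      proof (rule mult_mono)
        show "(real n + 3) powr (- p) \<le> (1 + \<bar>x\<bar>) powr (- p)"
          using True p by (intro powr_mono2') auto
        show "0 \<le> D"
          using C by (simp add: D_def le_max_iff_disj)
      qed (auto simp: D_def)
      finally show ?thesis .
    next
      case False
      define s where "s = \<bar>x + real (Suc n)\<bar>"
      have s: "s \<ge> 1" "1 + \<bar>x\<bar> \<le> s + (real n + 2)"
        using False by (auto simp: s_def)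
      moreover have "real n + 2 \<le> (real n + 2) * s"
        using s mult_left_mono[of 1 s "real n + 2"] by simp
      ultimately have "1 + \<bar>x\<bar> \<le> (real n + 3) * s"
        by (simp add: distrib_right)
      then have s': "(1 + \<bar>x\<bar>) / (real n + 3) \<le> s"
        by (simp add: divide_le_eq mult.commute)
      have "norm (of_real x + of_nat (Suc n) :: complex) = s"
        unfolding s_def by (metis norm_of_real of_real_add of_real_of_nat_eq)
      then have "norm (cbinom w (of_real x) / (of_real x + of_nat (Suc n))) = norm (cbinom w (of_real x)) / s"
        by (simp only: norm_divide)
      also have "\<dots> \<le> (C * (1 + \<bar>x\<bar>) powr (- (Re w + 1))) / ((1 + \<bar>x\<bar>) / (real n + 3))"
        using C s' by (intro frac_le) (auto simp: add_pos_nonneg)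
      also have "\<dots> = C * (real n + 3) * (1 + \<bar>x\<bar>) powr (- p)"
        unfolding p_def by (subst powr_minus_add_one) auto
      also have "\<dots> \<le> D * (1 + \<bar>x\<bar>) powr (- p)"
        unfolding D_def by (intro mult_right_mono) auto
      finally show ?thesis .
    qed
  qed measurable
qed

section \<open>Evaluation of the integral\<close>

text \<open>Termwise integration over (0, pi): the end t = 0 gives the plain series, and the end t =
  pi gives e^(i pi \<alpha>) times the alternating series, which is the beta function.\<close>

lemma integral_half_arc_powr:
  assumes w: "Re w > -1" and \<alpha>: "\<alpha> \<notin> \<int>\<^sub>\<le>\<^sub>0"
  shows "- \<i> * (LINT t|lborel. indicator {0<..<pi} t *\<^sub>R (arc_powr 1 w t * exp (\<i> * \<alpha> * of_real t))) =
           (\<Sum>k. (w gchoose k) / (of_nat k + \<alpha>)) - exp (\<i> * of_real pi * \<alpha>) * Beta (w + 1) \<alpha>"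
proof -
  define c where "c = (\<lambda>k. (w gchoose k) / (of_nat k + \<alpha>))"
  have sum_c: "summable (\<lambda>k. norm (c k))"
    unfolding c_def by (rule summable_norm_gbinomial_divide[OF w])
  have "summable (\<lambda>k. norm ((- 1) ^ k * c k))"
    using sum_c by (simp add: norm_mult norm_power)
  then have sum_alt: "summable (\<lambda>k. (- 1) ^ k * c k)"
    by (rule summable_norm_cancel)
  have term_eq: "c k * ((exp (\<i> * (of_nat k + \<alpha>) * of_real pi) - exp (\<i> * (of_nat k + \<alpha>) * of_real 0)) / \<i>) =
      \<i> * (c k - exp (\<i> * of_real pi * \<alpha>) * ((- 1) ^ k * c k))" for k
  proof -
    have "\<i> * (of_nat k + \<alpha>) * of_real pi = \<i> * of_real pi * \<alpha> + of_nat k * (\<i> * of_real pi)"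
      by (simp add: algebra_simps)
    then have "exp (\<i> * (of_nat k + \<alpha>) * of_real pi) = exp (\<i> * of_real pi * \<alpha>) * exp (\<i> * of_real pi) ^ k"
      by (simp only: exp_add exp_of_nat_mult)
    then show ?thesis
      by (simp add: algebra_simps)
  qed
  have "(LINT t|lborel. indicator {0<..<pi} t *\<^sub>R (arc_powr 1 w t * exp (\<i> * \<alpha> * of_real t))) =
          (\<Sum>k. c k * ((exp (\<i> * (of_nat k + \<alpha>) * of_real pi) - exp (\<i> * (of_nat k + \<alpha>) * of_real 0)) / \<i>))"
    unfolding c_def by (rule integral_arc_powr[OF w \<alpha>]) auto
  also have "\<dots> = (\<Sum>k. \<i> * (c k - exp (\<i> * of_real pi * \<alpha>) * ((- 1) ^ k * c k)))"
    by (simp only: term_eq)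
  also have "\<dots> = \<i> * (suminf c - exp (\<i> * of_real pi * \<alpha>) * (\<Sum>k. (- 1) ^ k * c k))"
    using suminf_mult[OF summable_diff[OF summable_norm_cancel[OF sum_c] summable_mult[OF sum_alt]]]
      suminf_diff[OF summable_norm_cancel[OF sum_c] summable_mult[OF sum_alt]] suminf_mult[OF sum_alt]
    by (simp only:)
  also have "(\<Sum>k. (- 1) ^ k * c k) = Beta (w + 1) \<alpha>"
    unfolding c_def by (rule suminf_gbinomial_eq_Beta[OF w \<alpha>])
  finally show ?thesis
    by (simp add: c_def)
qed

lemma integrable_half_arc_powr:
  assumes w: "Re w > -1" and \<alpha>: "Im \<alpha> > 0"
  shows "integrable lborel (\<lambda>t. indicator {0<..<pi} t *\<^sub>R (arc_powr 1 w t * exp (\<i> * \<alpha> * of_real t)))"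
proof (rule Bochner_Integration.integrable_bound[OF integrable_arc_powr[OF w]])
  show "AE t in lborel. norm (indicator {0<..<pi} t *\<^sub>R (arc_powr 1 w t * exp (\<i> * \<alpha> * of_real t))) \<le> norm (arc_powr 1 w t)"
    using \<alpha> by (intro AE_I2) (auto simp: indicator_def norm_mult intro: mult_left_le)
qed measurable

text \<open>The Fourier representation is inserted for \<open>cbinom\<close> and the order of
  integration exchanged. The inner integral over \<open>x\<close> is then the transform of the pole
  difference, which vanishes for t < 0 and so cuts the arc down to (0, pi).\<close>

lemma integral_cbinom_pole_difference:
  assumes w: "Re w > -1" and \<alpha>: "Im \<alpha> > 0" and \<beta>: "Im \<beta> > 0"
  shows "(LINT x|lborel. cbinom w (of_real x) / (of_real x + \<alpha>)) - (LINT x|lborel. cbinom w (of_real x) / (of_real x + \<beta>)) =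
    - \<i> * (LINT t|lborel. indicator {0<..<pi} t *\<^sub>R (arc_powr 1 w t * exp (\<i> * \<alpha> * of_real t)))
    - - \<i> * (LINT t|lborel. indicator {0<..<pi} t *\<^sub>R (arc_powr 1 w t * exp (\<i> * \<beta> * of_real t)))"
    (is "?F \<alpha> - ?F \<beta> = - \<i> * ?J \<alpha> - - \<i> * ?J \<beta>")
proof -
  define k where "k = (\<lambda>x::real. 1 / (of_real x + \<alpha>) - 1 / (of_real x + \<beta>))"
  define f where "f = (\<lambda>x t::real. k x * (arc_powr 1 w t * exp (- (\<i> * of_real x * of_real t))))"
  have k_meas [measurable]: "k \<in> borel_measurable borel"
    unfolding k_def by measurable
  have k_int: "integrable lborel k"
    unfolding k_def by (rule integrable_pole_difference[OF \<alpha> \<beta>])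
  have [measurable]: "arc_powr 1 w \<in> borel_measurable borel"
    by (rule borel_measurable_arc_powr) simp
  have f_meas: "case_prod f \<in> borel_measurable (lborel \<Otimes>\<^sub>M lborel)"
    unfolding f_def by measurable
  \<comment> \<open>For real \<open>x\<close> and \<open>t\<close> the exponential has modulus 1, so
    the norm factors into two integrable functions of one variable each.\<close>
  have norm_f: "norm (f x t) = norm (k x) * norm (arc_powr 1 w t)" for x t
    by (simp add: f_def norm_mult)
  have f_int: "integrable (lborel \<Otimes>\<^sub>M lborel) (case_prod f)"
  proof (rule lborel_pair.Fubini_integrable[OF f_meas])
    show "integrable lborel (\<lambda>x. LINT t|lborel. norm (case_prod f (x, t)))"
      using k_int by (simp add: norm_f integrable_norm)
    have "integrable lborel (f x)" for x
      by (rule Bochner_Integration.integrable_bound[OF integrable_mult_right[OF integrable_arc_powr[OF w], of "k x"]])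
        (auto simp: f_def norm_mult)
    then show "AE x in lborel. integrable lborel (\<lambda>t. case_prod f (x, t))"
      by simp
  qed
  have "?F \<alpha> - ?F \<beta> =
      (LINT x|lborel. cbinom w (of_real x) / (of_real x + \<alpha>) - cbinom w (of_real x) / (of_real x + \<beta>))"
    by (intro Bochner_Integration.integral_diff [symmetric] integrable_cbinom_divide_upper_half_plane w \<alpha> \<beta>)
  also have "\<dots> = (LINT x|lborel. k x * cbinom w (of_real x))"
    by (intro Bochner_Integration.integral_cong) (auto simp: k_def left_diff_distrib)
  finally have "2 * of_real pi * (?F \<alpha> - ?F \<beta>) = (LINT x|lborel. 2 * of_real pi * (k x * cbinom w (of_real x)))"
    by (simp only: integral_mult_right_zero)
  also have "\<dots> = (LINT x|lborel. LINT t|lborel. f x t)"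
  proof (rule integral_cong_AE)
    have "AE x in lborel. x \<notin> (\<int> :: real set)"
      by (intro AE_not_in countable_imp_null_set_lborel countable_int)
    then show "AE x in lborel. 2 * of_real pi * (k x * cbinom w (of_real x)) = (LINT t|lborel. f x t)"
    proof eventually_elim
      case (elim x)
      then show ?case
        using cbinom_eq_integral_arc_powr[OF w, of x] by (simp add: f_def mult_ac)
    qed
    show "(\<lambda>x. LINT t|lborel. f x t) \<in> borel_measurable lborel"
      using f_meas by (rule lborel.borel_measurable_lebesgue_integral)
  qed measurable
  also have "\<dots> = (LINT t|lborel. LINT x|lborel. f x t)"
    by (rule lborel_pair.Fubini_integral[OF f_int, symmetric])
  also have "\<dots> = (LINT t|lborel. - 2 * of_real pi * \<i> *
      (indicator {0<..<pi} t *\<^sub>R (arc_powr 1 w t * exp (\<i> * \<alpha> * of_real t))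
        - indicator {0<..<pi} t *\<^sub>R (arc_powr 1 w t * exp (\<i> * \<beta> * of_real t))))"
  proof (rule integral_cong_AE)
    have "AE t in lborel. t \<noteq> (0::real)"
      by (rule AE_lborel_singleton)
    then show "AE t in lborel. (LINT x|lborel. f x t) = - 2 * of_real pi * \<i> *
      (indicator {0<..<pi} t *\<^sub>R (arc_powr 1 w t * exp (\<i> * \<alpha> * of_real t))
        - indicator {0<..<pi} t *\<^sub>R (arc_powr 1 w t * exp (\<i> * \<beta> * of_real t)))"
    proof eventually_elim
      case (elim t)
      have "(LINT x|lborel. f x t) = (LINT x|lborel. arc_powr 1 w t * (k x * exp (- (\<i> * of_real t * of_real x))))"
        by (intro Bochner_Integration.integral_cong) (auto simp: f_def mult_ac)
      also have "\<dots> = arc_powr 1 w t * (if t > 0 then - 2 * of_real pi * \<i> * (exp (\<i> * \<alpha> * of_real t) - exp (\<i> * \<beta> * of_real t)) else 0)"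
        unfolding k_def by (subst fourier_pole_difference[OF \<alpha> \<beta> elim, symmetric]) (rule integral_mult_right_zero)
      also have "\<dots> = - 2 * of_real pi * \<i> *
        (indicator {0<..<pi} t *\<^sub>R (arc_powr 1 w t * exp (\<i> * \<alpha> * of_real t))
          - indicator {0<..<pi} t *\<^sub>R (arc_powr 1 w t * exp (\<i> * \<beta> * of_real t)))"
        by (auto simp: arc_powr_def indicator_def algebra_simps)
      finally show ?case .
    qed
    have "case_prod (\<lambda>t x. f x t) \<in> borel_measurable (lborel \<Otimes>\<^sub>M lborel)"
      unfolding f_def by measurable
    then show "(\<lambda>t. LINT x|lborel. f x t) \<in> borel_measurable lborel"
      by (rule lborel.borel_measurable_lebesgue_integral)
  qed measurable
  also have "\<dots> = - 2 * of_real pi * \<i> * (?J \<alpha> - ?J \<beta>)"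
    using integrable_half_arc_powr[OF w \<alpha>] integrable_half_arc_powr[OF w \<beta>]
    by (simp only: integral_mult_right_zero Bochner_Integration.integral_diff)
  also have "\<dots> = 2 * of_real pi * (- \<i> * ?J \<alpha> - - \<i> * ?J \<beta>)"
    by (simp add: algebra_simps)
  finally show ?thesis
    by simp
qed

text \<open>The preceding identity says that F(\<gamma>) + i J(\<gamma>) does not depend on
  \<gamma>. Both F and J tend to 0 as \<gamma> moves up the imaginary axis, so the constant is
  0.\<close>

lemma integral_cbinom_divide_upper_half_plane:
  assumes w: "Re w > -1" and \<alpha>: "Im \<alpha> > 0"
  shows "(LINT x|lborel. cbinom w (of_real x) / (of_real x + \<alpha>)) =
           (\<Sum>k. (w gchoose k) / (of_nat k + \<alpha>)) - exp (\<i> * of_real pi * \<alpha>) * Beta (w + 1) \<alpha>"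
proof -
  define F where "F = (\<lambda>\<gamma>. LINT x|lborel. cbinom w (of_real x) / (of_real x + \<gamma>))"
  define J where "J = (\<lambda>\<gamma>. LINT t|lborel. indicator {0<..<pi} t *\<^sub>R (arc_powr 1 w t * exp (\<i> * \<gamma> * of_real t)))"
  define \<beta> where "\<beta> = (\<lambda>n. \<i> * of_nat (Suc n))"
  have \<beta>: "Im (\<beta> n) > 0" for n
    by (simp add: \<beta>_def)
  have [measurable]: "arc_powr 1 w \<in> borel_measurable borel"
    by (rule borel_measurable_arc_powr) simp
  have "(\<lambda>n. F (\<beta> n)) \<longlonglongrightarrow> (LINT x::real|lborel. (0::complex))"
    unfolding F_def
  proof (rule integral_dominated_convergence)
    \<comment> \<open>The first pole, \<open>\<beta> 0\<close> = i, gives the majorant: moving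
      further up only enlarges the denominator.\<close>
    show "integrable lborel (\<lambda>x. norm (cbinom w (of_real x) / (of_real x + \<i>)))"
      using w by (intro integrable_norm integrable_cbinom_divide_upper_half_plane) auto
    show "AE x in lborel. (\<lambda>n. cbinom w (of_real x) / (of_real x + \<beta> n)) \<longlonglongrightarrow> 0"
    proof (rule AE_I2)
      fix x :: real
      show "(\<lambda>n. cbinom w (of_real x) / (of_real x + \<beta> n)) \<longlonglongrightarrow> 0"
      proof (rule Lim_null_comparison)
        show "\<forall>\<^sub>F n in sequentially. norm (cbinom w (of_real x) / (of_real x + \<beta> n)) \<le> norm (cbinom w (of_real x)) / real (Suc n)"
        proof (intro always_eventually allI)
          fix n
          have "real (Suc n) \<le> norm (of_real x + \<beta> n)"
            using abs_Im_le_cmod[of "of_real x + \<beta> n"] by (simp add: \<beta>_def)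
          then show "norm (cbinom w (of_real x) / (of_real x + \<beta> n)) \<le> norm (cbinom w (of_real x)) / real (Suc n)"
            unfolding norm_divide by (intro divide_left_mono mult_pos_pos) (auto simp: norm_divide)
        qed
        show "(\<lambda>n. norm (cbinom w (of_real x)) / real (Suc n)) \<longlonglongrightarrow> 0"
          by real_asymp
      qed
    qed
    show "AE x in lborel. norm (cbinom w (of_real x) / (of_real x + \<beta> n))
        \<le> norm (cbinom w (of_real x) / (of_real x + \<i>))" for n
    proof (rule AE_I2)
      fix x :: real
      have "norm (of_real x + \<i>) \<le> norm (of_real x + \<beta> n)"
        unfolding cmod_def by (simp add: \<beta>_def)
      moreover have "norm (of_real x + \<i>) > 0"
        by (auto simp: complex_eq_iff)
      ultimately show "norm (cbinom w (of_real x) / (of_real x + \<beta> n))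
        \<le> norm (cbinom w (of_real x) / (of_real x + \<i>))"
        unfolding norm_divide by (intro frac_le) auto
    qed
  qed measurable
  moreover have "(\<lambda>n. J (\<beta> n)) \<longlonglongrightarrow> (LINT t::real|lborel. (0::complex))"
    unfolding J_def
  proof (rule integral_dominated_convergence)
    show "integrable lborel (\<lambda>t. norm (arc_powr 1 w t))"
      by (intro integrable_norm integrable_arc_powr w)
    show "AE t in lborel. (\<lambda>n. indicator {0<..<pi} t *\<^sub>R (arc_powr 1 w t * exp (\<i> * \<beta> n * of_real t))) \<longlonglongrightarrow> 0"
    proof (rule AE_I2)
      fix t :: real
      show "(\<lambda>n. indicator {0<..<pi} t *\<^sub>R (arc_powr 1 w t * exp (\<i> * \<beta> n * of_real t))) \<longlonglongrightarrow> 0"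
      proof (cases "t > 0")
        case True
        have "\<i> * \<beta> n * of_real t = of_real (- (real (Suc n) * t))" for n
          by (simp add: \<beta>_def complex_eq_iff algebra_simps)
        then have "(\<lambda>n. exp (\<i> * \<beta> n * of_real t)) = (\<lambda>n. of_real (exp (- (real (Suc n) * t))))"
          by (simp only: exp_of_real)
        moreover have "(\<lambda>n. exp (- (real (Suc n) * t))) \<longlonglongrightarrow> 0"
          using True by real_asymp
        ultimately have "(\<lambda>n. exp (\<i> * \<beta> n * of_real t)) \<longlonglongrightarrow> 0"
          using tendsto_of_real[of _ "0::real" sequentially, where 'a = complex] by simp
        from tendsto_scaleR[OF tendsto_const tendsto_mult[OF tendsto_const this]] show ?thesis
          by simp
      qed simp
    qed
    show "AE t in lborel. norm (indicator {0<..<pi} t *\<^sub>R (arc_powr 1 w t * exp (\<i> * \<beta> n * of_real t)))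
        \<le> norm (arc_powr 1 w t)" for n
      using \<beta>[of n] by (intro AE_I2) (auto simp: indicator_def norm_mult intro: mult_left_le)
  qed measurable
  \<comment> \<open>This sequence is constantly \<open>F \<alpha>\<close>, as shown next, so its
    limit determines \<open>F \<alpha>\<close>.\<close>
  ultimately have "(\<lambda>n. F (\<beta> n) + - \<i> * J \<alpha> - - \<i> * J (\<beta> n)) \<longlonglongrightarrow> 0 + - \<i> * J \<alpha> - - \<i> * 0"
    by (intro tendsto_intros) simp_all
  moreover have "F (\<beta> n) + - \<i> * J \<alpha> - - \<i> * J (\<beta> n) = F \<alpha>" for n
    using integral_cbinom_pole_difference[OF w \<alpha> \<beta>[of n]] unfolding F_def J_def by (simp add: algebra_simps)
  ultimately have "F \<alpha> = - \<i> * J \<alpha>"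
    by (simp add: LIMSEQ_const_iff)
  then show ?thesis
    using integral_half_arc_powr[OF w Im_pos_notin_nonpos_Ints[OF \<alpha>]] by (simp only: F_def J_def)
qed

text \<open>The point \<open>a\<close> is approached vertically from above. Then |x + a| <= |x +
  \<alpha>_n|, so the integrand at \<open>a\<close> itself dominates, and the right side is
  continuous at \<open>a\<close> because it is holomorphic off the nonpositive integers.\<close>

lemma integral_cbinom_divide_pos_int:
  fixes w :: complex and m :: nat
  assumes w: "Re w > -1"
  defines "a \<equiv> of_nat (Suc m) :: complex"
  shows "(LINT x|lborel. cbinom w (of_real x) / (of_real x + a)) =
           (\<Sum>k. (w gchoose k) / (of_nat k + a)) - exp (\<i> * of_real pi * a) * Beta (w + 1) a"
proof -
  define rhs where "rhs = (\<lambda>\<alpha>. (\<Sum>k. (w gchoose k) / (of_nat k + \<alpha>)) - exp (\<i> * of_real pi * \<alpha>) * Beta (w + 1) \<alpha>)"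
  define \<alpha> where "\<alpha> = (\<lambda>n. a + \<i> / of_nat (Suc n))"
  have \<alpha>: "Im (\<alpha> n) > 0" for n
    by (simp add: \<alpha>_def a_def Im_divide_of_nat del: of_nat_Suc)
  have \<alpha>_lim: "\<alpha> \<longlonglongrightarrow> a"
    unfolding \<alpha>_def
    using tendsto_add[OF tendsto_const tendsto_mult[OF tendsto_const LIMSEQ_Suc[OF lim_1_over_n]], of a \<i>] by simp
  have a: "a \<in> UNIV - \<int>\<^sub>\<le>\<^sub>0"
    by (auto simp: a_def complex_eq_iff elim!: nonpos_Ints_cases simp del: of_nat_Suc)
  have "rhs holomorphic_on UNIV - \<int>\<^sub>\<le>\<^sub>0"
  proof -
    have "(\<lambda>\<alpha>. \<Sum>k. 1 * ((w gchoose k) / (of_nat k + \<alpha>))) holomorphic_on UNIV - \<int>\<^sub>\<le>\<^sub>0"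
      using w by (intro holomorphic_suminf_gbinomial_divide holomorphic_intros) (auto simp: open_Diff)
    then show ?thesis
      unfolding rhs_def using add_one_notin_nonpos_Ints[OF w]
      by (intro holomorphic_intros) auto
  qed
  then have "isCont rhs a"
    using a by (intro holomorphic_on_imp_continuous_on[THEN continuous_on_interior]) (auto simp: interior_open open_Diff)
  then have rhs_lim: "(\<lambda>n. rhs (\<alpha> n)) \<longlonglongrightarrow> rhs a"
    using \<alpha>_lim by (rule isCont_tendsto_compose)
  have "(\<lambda>n. LINT x|lborel. cbinom w (of_real x) / (of_real x + \<alpha> n)) \<longlonglongrightarrow> (LINT x|lborel. cbinom w (of_real x) / (of_real x + a))"
  proof (rule integral_dominated_convergence)
    show "integrable lborel (\<lambda>x. norm (cbinom w (of_real x) / (of_real x + a)))"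
      unfolding a_def by (intro integrable_norm integrable_cbinom_divide_pos_int w)
    \<comment> \<open>At this point x + a = 0 and the majorant is 0 by convention, so it is set
      aside as a null set.\<close>
    have ae: "AE x in lborel. x \<noteq> - real (Suc m)"
      by (rule AE_lborel_singleton)
    have nz: "of_real x + a \<noteq> 0" if "x \<noteq> - real (Suc m)" for x
      using that by (auto simp: a_def complex_eq_iff)
    show "AE x in lborel. (\<lambda>n. cbinom w (of_real x) / (of_real x + \<alpha> n)) \<longlonglongrightarrow> cbinom w (of_real x) / (of_real x + a)"
      using ae by eventually_elim (intro tendsto_intros \<alpha>_lim nz)
    show "AE x in lborel. norm (cbinom w (of_real x) / (of_real x + \<alpha> n)) \<le> norm (cbinom w (of_real x) / (of_real x + a))" for n
      using ae
    proof eventually_elim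
      case (elim x)
      have "norm (of_real x + a) \<le> norm (of_real x + \<alpha> n)"
        unfolding cmod_def
        by (simp add: \<alpha>_def a_def Re_divide_of_nat del: of_nat_Suc)
      with nz[OF elim] show ?case
        unfolding norm_divide by (intro frac_le) auto
    qed
  qed measurable
  moreover have "(LINT x|lborel. cbinom w (of_real x) / (of_real x + \<alpha> n)) = rhs (\<alpha> n)" for n
    unfolding rhs_def by (rule integral_cbinom_divide_upper_half_plane[OF w \<alpha>])
  ultimately have "(LINT x|lborel. cbinom w (of_real x) / (of_real x + a)) = rhs a"
    using rhs_lim LIMSEQ_unique by simp
  then show ?thesis
    by (simp add: rhs_def)
qed

text \<open>Integrability and summability are asserted alongside the identity because only then do
  the integral and the infinite sum carry their intended meaning instead of a default value.\<close>

theorem mainTheorem8: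
  fixes w \<alpha> :: complex
  assumes "Re w > -1"
    and "Im \<alpha> > 0 \<or> (\<exists>n::int. n \<ge> 1 \<and> \<alpha> = of_int n)"
  shows "integrable lborel (\<lambda>x::real. cbinom w (of_real x) * (1 / (of_real x + \<alpha>))) \<and>
         summable (\<lambda>k::nat. cbinom w (of_nat k) * (1 / (of_nat k + \<alpha>))) \<and>
         (LBINT x. cbinom w (of_real x) * (1 / (of_real x + \<alpha>))) =
           (\<Sum>k::nat. cbinom w (of_nat k) * (1 / (of_nat k + \<alpha>)))
             - exp (\<i> * of_real pi * \<alpha>) * Beta (w + 1) \<alpha>"
proof -
  have "integrable lborel (\<lambda>x. cbinom w (of_real x) / (of_real x + \<alpha>)) \<and>
      (LINT x|lborel. cbinom w (of_real x) / (of_real x + \<alpha>)) =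
        (\<Sum>k. (w gchoose k) / (of_nat k + \<alpha>)) - exp (\<i> * of_real pi * \<alpha>) * Beta (w + 1) \<alpha>"
    using assms(2)
  proof
    assume "Im \<alpha> > 0"
    then show ?thesis
      using integrable_cbinom_divide_upper_half_plane integral_cbinom_divide_upper_half_plane assms(1) by blast
  next
    assume "\<exists>n::int. n \<ge> 1 \<and> \<alpha> = of_int n"
    then obtain n :: int where n: "n \<ge> 1" "\<alpha> = of_int n"
      by blast
    \<comment> \<open>The successor form matches the preceding lemmas, whose pole parameter m + 1
      starts at 1.\<close>
    then have "\<alpha> = of_nat (Suc (nat (n - 1)))"
      by simp
    then show ?thesis
      using integrable_cbinom_divide_pos_int integral_cbinom_divide_pos_int assms(1) by blast
  qed
  moreover have "summable (\<lambda>k. (w gchoose k) / (of_nat k + \<alpha>))"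
    using summable_norm_gbinomial_divide[OF assms(1)] by (rule summable_norm_cancel)
  moreover have "cbinom w (of_nat k) = w gchoose k" for k
    by (rule cbinom_of_nat[OF add_one_notin_nonpos_Ints[OF assms(1)]])
  ultimately show ?thesis
    by simp
qed

end
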